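(* Let $H$ be a real Hilbert space, $X\subset H$ a dense linear subspace, $V\subset H$ an open neighborhood of the origin $\theta$, and let $\mathcal{L}\in C^1(V,\mathbb{R})$ with $\mathcal{L}'(\theta)=0$ satisfy Hypothesis (A) of the context, with $B=P+Q$. Let $H=H^+\oplus H^0\oplus H^-$ be the decomposition associated with $B(\theta)$. If $\theta$ is nondegenerate, i.e. $H^0=\mathrm{Ker}\,B(\theta)=\{\theta\}$, then $\theta$ is an isolated critical point of $\mathcal{L}$, and there exist a small $\epsilon>0$, an open neighborhood $W$ of $\theta$ in $H$ and an origin-preserving homeomorphism $\phi:B_{H^+}(\theta,\epsilon)+B_{H^-}(\theta,\epsilon)\to W$ such that $$\mathcal{L}\circ\phi(u^++u^-)=\|u^+\|^2-\|u^-\|^2+\mathcal{L}(\theta)\qquad\forall (u^+,u^-)\in B_{H^+}(\theta,\epsilon)\times B_{H^-}(\theta,\epsilon).$$ Moreover, if $\hat H$ is a closed subspace of $H$ containing $H^-$, and $\hat H^+=\hat H\cap H^+$ is the orthogonal complement of $H^-$ in $\hat H$, then $\phi$ restricts to a homeomorphism $\hat\phi: B_{\hat H^+}(\theta,\epsilon)+B_{H^-}(\theta,\epsilon)\to\hat W:=W\cap\hat H$, and $\mathcal{L}\circ\hat\phi(u^++u^-)=\|u^+\|^2-\|u^-\|^2+\mathcal{L}(\theta)$ for all $(u^+,u^-)\in B_{\hat H^+}(\theta,\epsilon)\times B_{H^-}(\theta,\epsilon)$.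
   Context: Notation: $(\cdot,\cdot)_H$ and $\|\cdot\|$ are the inner product and norm of $H$; $\mathscr{L}_s(H)$ is the space of bounded self-adjoint operators on $H$; $B_Y(\theta,r)$ is the open ball of radius $r$ centred at the origin of $Y$; $\nabla\mathcal{L}$ is the gradient of $\mathcal{L}$. Hypothesis (A): the gradient $\nabla\mathcal{L}:V\to H$ has a Gâteaux derivative $B(u)\in\mathscr{L}_s(H)$ at every $u\in V\cap X$, and $B:V\cap X\to\mathscr{L}_s(H)$ has a decomposition $B=P+Q$, where for each $x\in V\cap X$ the operator $P(x)\in\mathscr{L}_s(H)$ is positive definite (spectrum contained in $(0,\infty)$) and $Q(x)\in\mathscr{L}_s(H)$ is compact, and: (D1) all eigenvectors of $B(\theta)$ corresponding to non-positive eigenvalues belong to $X$; (D2) for any sequence $(x_k)\subset V\cap X$ with $\|x_k\|\to0$, $\|P(x_k)u-P(\theta)u\|\to0$ for every $u\in H$; (D3) $Q:V\cap X\to\mathscr{L}(H)$ is continuous at $\theta$ with respect to the topology of $H$ on $V\cap X$; (D4) for any sequence $(x_k)\subset V\cap X$ with $\|x_k\|\to0$ there exist $C_0>0$ and $k_0\in\mathbb{N}$ such that $(P(x_k)u,u)_H\ge C_0\|u\|^2$ for all $u\in H$ and all $k\ge k_0$. $H^+,H^0,H^-$ are the positive definite, null and negative definite spaces of $B(\theta)$ (an orthogonal decomposition; under (A), $H^0$ and $H^-$ are finite dimensional and $0$ is at most an isolated point of the spectrum of $B(\theta)$). *)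

theory Defs
  imports "HOL-Analysis.Analysis" "HOL-Library.Set_Algebras"
begin

text \<open>
  A real Hilbert space is a type of class \<open>{real_inner, complete_space}\<close>; bounded operators on it
  are elements of the type \<open>'a \<Rightarrow>\<^sub>L 'a\<close>, which carries the operator norm.
  Maps that are only defined on \<open>V\<close> or \<open>V \<inter> X\<close> are total functions of which nothing is assumed
  outside that set.
\<close>

definition self_adjoint :: "('a::real_inner \<Rightarrow>\<^sub>L 'a) \<Rightarrow> bool" where
  "self_adjoint T \<longleftrightarrow> (\<forall>u v. T u \<bullet> v = u \<bullet> T v)"

text \<open>
  The real points of the spectrum. For a self-adjoint operator this is the whole spectrum of its
  complexification.
\<close>

definition spectrum :: "('a::real_normed_vector \<Rightarrow>\<^sub>L 'a) \<Rightarrow> real set" where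
  "spectrum T = {l. \<not> (\<exists>S. S o\<^sub>L (T - l *\<^sub>R id_blinfun) = id_blinfun \<and>
                           (T - l *\<^sub>R id_blinfun) o\<^sub>L S = id_blinfun)}"

definition positive_definite_op :: "('a::real_inner \<Rightarrow>\<^sub>L 'a) \<Rightarrow> bool" where
  "positive_definite_op T \<longleftrightarrow> self_adjoint T \<and> spectrum T \<subseteq> {0<..}"

definition compact_op :: "('a::real_normed_vector \<Rightarrow>\<^sub>L 'a) \<Rightarrow> bool" where
  "compact_op T \<longleftrightarrow> (\<forall>S. bounded S \<longrightarrow> compact (closure (T ` S)))"

text \<open>
  The positive definite, null and negative definite spaces of a self-adjoint operator.
  The first and the last are the largest closed invariant subspaces on which the quadratic form is
  positive, respectively negative, definite; these are the ranges of the spectral projections for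
  \<open>(0, \<infinity>)\<close> and \<open>(-\<infinity>, 0)\<close>, and in particular belong to the families below.
\<close>

definition pos_space :: "('a::real_inner \<Rightarrow>\<^sub>L 'a) \<Rightarrow> 'a set" where
  "pos_space T = \<Union>{S. subspace S \<and> closed S \<and> T ` S \<subseteq> S \<and> (\<forall>u\<in>S. u \<noteq> 0 \<longrightarrow> T u \<bullet> u > 0)}"

definition null_space :: "('a::real_inner \<Rightarrow>\<^sub>L 'a) \<Rightarrow> 'a set" where
  "null_space T = {u. T u = 0}"

definition neg_space :: "('a::real_inner \<Rightarrow>\<^sub>L 'a) \<Rightarrow> 'a set" where
  "neg_space T = \<Union>{S. subspace S \<and> closed S \<and> T ` S \<subseteq> S \<and> (\<forall>u\<in>S. u \<noteq> 0 \<longrightarrow> T u \<bullet> u < 0)}"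

definition C1_on :: "'a::real_normed_vector set \<Rightarrow> ('a \<Rightarrow> real) \<Rightarrow> bool" where
  "C1_on V f \<longleftrightarrow> (\<exists>f' :: 'a \<Rightarrow> ('a \<Rightarrow>\<^sub>L real).
      (\<forall>u\<in>V. (f has_derivative blinfun_apply (f' u)) (at u)) \<and> continuous_on V f')"

definition critical_points :: "'a::real_normed_vector set \<Rightarrow> ('a \<Rightarrow> real) \<Rightarrow> 'a set" where
  "critical_points V f = {u \<in> V. (f has_derivative (\<lambda>h. 0)) (at u)}"

definition has_gateaux_derivative ::
    "('a::real_normed_vector \<Rightarrow> 'b::real_normed_vector) \<Rightarrow> ('a \<Rightarrow>\<^sub>L 'b) \<Rightarrow> 'a \<Rightarrow> bool" where
  "has_gateaux_derivative f T u \<longleftrightarrow>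
     (\<forall>h. ((\<lambda>t::real. (f (u + t *\<^sub>R h) - f u) /\<^sub>R t) \<longlongrightarrow> T h) (at 0))"

text \<open>Here \<open>g\<close> is the gradient of the functional.\<close>

definition hypothesis_A ::
    "'a::real_inner set \<Rightarrow> 'a set \<Rightarrow> ('a \<Rightarrow> 'a) \<Rightarrow> ('a \<Rightarrow> 'a \<Rightarrow>\<^sub>L 'a) \<Rightarrow>
     ('a \<Rightarrow> 'a \<Rightarrow>\<^sub>L 'a) \<Rightarrow> ('a \<Rightarrow> 'a \<Rightarrow>\<^sub>L 'a) \<Rightarrow> bool" where
  "hypothesis_A V X g B P Q \<longleftrightarrow>
     (\<forall>u \<in> V \<inter> X. self_adjoint (B u) \<and> has_gateaux_derivative g (B u) u) \<and>
     (\<forall>x \<in> V \<inter> X. B x = P x + Q x \<and> positive_definite_op (P x) \<and>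
                    self_adjoint (Q x) \<and> compact_op (Q x)) \<and>
     (\<forall>l u. l \<le> 0 \<and> u \<noteq> 0 \<and> B 0 u = l *\<^sub>R u \<longrightarrow> u \<in> X) \<and>
     (\<forall>x :: nat \<Rightarrow> 'a. (\<forall>k. x k \<in> V \<inter> X) \<and> (\<lambda>k. norm (x k)) \<longlonglongrightarrow> 0 \<longrightarrow>
        (\<forall>u. (\<lambda>k. norm (P (x k) u - P 0 u)) \<longlonglongrightarrow> 0)) \<and>
     continuous (at 0 within V \<inter> X) Q \<and>
     (\<forall>x :: nat \<Rightarrow> 'a. (\<forall>k. x k \<in> V \<inter> X) \<and> (\<lambda>k. norm (x k)) \<longlonglongrightarrow> 0 \<longrightarrow>
        (\<exists>C0>0. \<exists>k0. \<forall>u. \<forall>k\<ge>k0. P (x k) u \<bullet> u \<ge> C0 * (norm u)\<^sup>2))"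

end

(*
  Split H into the span N of the finitely many negative eigenvectors of B(0) and M = N^perp.
  Near 0 the operators B(x) are uniformly positive on M, and on N they are close in norm to B(0),
  hence uniformly negative; weak limits are avoided by working with approximate eigenvectors, which
  converge strongly because P - m is bounded below for m <= 0.  By the mean value theorem on the
  dense subspace X and continuity of the gradient g, monotonicity estimates for g along M and N
  follow on a full neighbourhood of 0.  They give for every small x in M a unique maximiser
  x + peak x of the functional on the fibre x + N.  The value at the peak increases strictly and
  quadratically along rays of M, and the functional drops strictly and quadratically along rays of
  N starting at the peak.  Taking the square roots of these two quantities as radial coordinates
  brings the functional to normal form.  As the M-component is only rescaled, all subspaces
  containing N are respected.
*)
theory Submission
  imports Defs
begin

text \<open>The operators \<open>B x\<close> exist only at points of \<open>X\<close>, and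
  \<open>P\<close> is continuous only in the strong sense, so \<open>L\<close> need not be twice
  differentiable. No implicit function theorem and no smooth change of variables is at hand;
  everything runs on two-point inequalities for the continuous gradient. Strong convergence is
  uniform on a finite-dimensional space, which settles \<open>N\<close>. On \<open>M\<close> only a
  lower bound can be hoped for, and it comes from compactness of \<open>Q 0\<close>: if it failed,
  \<open>B 0\<close> would have an eigenvector in \<open>M\<close> with non-positive eigenvalue. The
  estimates have the shape of a block matrix with diagonal blocks at least \<open>2 * b\<close> on
  \<open>M\<close> and at most \<open>- 2 * b\<close> on \<open>N\<close>, and off-diagonal blocks
  at most \<open>b\<close>. This dominance by a factor 2 makes the peak a 1/2-Lipschitz function of
  \<open>x\<close> and leaves a quadratic gain with constant \<open>b\<close> on the rays. As the
  peak is merely Lipschitz, it is never differentiated: it is held fixed while the base point moves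
  and is readjusted afterwards, and neither move lowers the functional.\<close>

section \<open>Strongly monotone maps and approximate eigenvectors\<close>

text \<open>The damped step \<open>u - t *\<^sub>R T u\<close> has squared Lipschitz factor at most
  1 - 2 t a + t^2 K^2, a bound that is smallest at t = a / K^2. The result serves linear equations
  with operators bounded below as well as the search for critical points on the fibres.\<close>

lemma strongly_monotone_zero:
  fixes T :: "'a::{real_inner, complete_space} \<Rightarrow> 'a"
  assumes S: "subspace S" "closed S" and r: "r \<ge> 0" and a: "a > 0"
    and T: "\<And>u. u \<in> S \<Longrightarrow> norm u \<le> r \<Longrightarrow> T u \<in> S"
    and mono: "\<And>u v. \<lbrakk>u \<in> S; v \<in> S; norm u \<le> r; norm v \<le> r\<rbrakk>
        \<Longrightarrow> (T u - T v) \<bullet> (u - v) \<ge> a * (norm (u - v))\<^sup>2"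
    and lip: "\<And>u v. \<lbrakk>u \<in> S; v \<in> S; norm u \<le> r; norm v \<le> r\<rbrakk>
        \<Longrightarrow> norm (T u - T v) \<le> C * norm (u - v)"
    and T0: "norm (T 0) \<le> a * r / 2"
  obtains u where "u \<in> S" "norm u \<le> r" "T u = 0"
proof -
  \<comment> \<open>The maximum with \<open>a\<close> makes \<open>K\<close> positive and a^2 / K^2
    at most 1 whatever \<open>C\<close> is, so that \<open>q\<close> is the root of a nonnegative
    number.\<close>
  define K where "K = max C a"
  have K: "K \<ge> a" "K > 0" "K \<ge> C" using a by (auto simp: K_def)
  define t where "t = a / K\<^sup>2"
  define q where "q = sqrt (1 - a\<^sup>2 / K\<^sup>2)"
  have aK: "a\<^sup>2 / K\<^sup>2 \<le> 1" "a\<^sup>2 / K\<^sup>2 > 0" using K a by (auto simp: power_mono)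
  have q0: "q \<ge> 0" using aK by (simp add: q_def)
  have t: "t > 0" using a K by (simp add: t_def)
  have qle: "q \<le> 1 - a\<^sup>2 / K\<^sup>2 / 2"
    unfolding q_def
  proof (rule real_le_lsqrt)
    show "1 - a\<^sup>2 / K\<^sup>2 \<le> (1 - a\<^sup>2 / K\<^sup>2 / 2)\<^sup>2"
      by (simp add: power2_diff)
  qed (use aK in auto)
  define F where "F u = u - t *\<^sub>R T u" for u
  have contr: "norm (F u - F v) \<le> q * norm (u - v)"
    if "u \<in> S" "v \<in> S" "norm u \<le> r" "norm v \<le> r" for u v
  proof -
    define d where "d = u - v"
    define e where "e = T u - T v"
    have e1: "e \<bullet> d \<ge> a * (norm d)\<^sup>2" using mono[OF that] by (simp add: d_def e_def)
    have "norm e \<le> C * norm d" using lip[OF that] by (simp add: d_def e_def)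
    also have "\<dots> \<le> K * norm d" using K by (intro mult_right_mono) auto
    finally have "(norm e)\<^sup>2 \<le> (K * norm d)\<^sup>2" by (intro power_mono) auto
    then have e2: "(norm e)\<^sup>2 \<le> K\<^sup>2 * (norm d)\<^sup>2" by (simp add: power_mult_distrib)
    have "F u - F v = d - t *\<^sub>R e" by (simp add: F_def d_def e_def algebra_simps)
    moreover have "(norm (d - t *\<^sub>R e))\<^sup>2 = (norm d)\<^sup>2 - 2 * t * (e \<bullet> d) + t\<^sup>2 * (norm e)\<^sup>2"
      unfolding power2_norm_eq_inner by (simp add: algebra_simps inner_commute power2_eq_square)
    ultimately have "(norm (F u - F v))\<^sup>2 = (norm d)\<^sup>2 - 2 * t * (e \<bullet> d) + t\<^sup>2 * (norm e)\<^sup>2"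
      by simp
    also have "\<dots> \<le> (norm d)\<^sup>2 - 2 * t * (a * (norm d)\<^sup>2) + t\<^sup>2 * (K\<^sup>2 * (norm d)\<^sup>2)"
      using t by (intro add_mono diff_mono mult_left_mono e1 e2) auto
    also have "\<dots> = (1 - a\<^sup>2 / K\<^sup>2) * (norm d)\<^sup>2"
      using K by (simp add: t_def field_simps power2_eq_square)
    also have "\<dots> = (q * norm d)\<^sup>2"
      using aK by (simp add: q_def power_mult_distrib)
    finally show ?thesis
      unfolding d_def by (rule power2_le_imp_le) (use q0 in auto)
  qed
  have self: "F ` (S \<inter> cball 0 r) \<subseteq> S \<inter> cball 0 r"
  proof (intro subsetI; elim imageE; simp, elim conjE, intro conjI)
    fix u assume u: "u \<in> S" "norm u \<le> r"
    show "F u \<in> S"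
      using u T[OF u] S(1) by (simp add: F_def subspace_diff subspace_scale)
    have "norm (F u) \<le> norm (F u - F 0) + norm (F 0)"
      by (metis diff_add_cancel norm_triangle_ineq)
    also have "norm (F u - F 0) \<le> q * norm u"
      using contr[of u 0] u S(1) r by (simp add: subspace_0)
    also have "norm (F 0) \<le> t * (a * r / 2)"
      using T0 t by (simp add: F_def mult_left_mono)
    \<comment> \<open>The gain a^2 / (2 K^2) of the contraction pays exactly for the displacement of
      the centre, t a r / 2.\<close>
    also have "q * norm u \<le> (1 - a\<^sup>2 / K\<^sup>2 / 2) * r"
      using qle u q0 by (intro mult_mono) auto
    also have "(1 - a\<^sup>2 / K\<^sup>2 / 2) * r + t * (a * r / 2) = r"
      using K by (simp add: t_def field_simps power2_eq_square)
    finally show "norm (F u) \<le> r" by simp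
  qed
  have "\<exists>!x. x \<in> S \<inter> cball 0 r \<and> F x = x"
  proof (rule Banach_fix)
    show "complete (S \<inter> cball 0 r)" using S by (simp add: complete_eq_closed closed_Int)
    show "S \<inter> cball 0 r \<noteq> {}" using subspace_0[OF S(1)] r by force
    show "q < 1" using aK by (simp add: q_def)
    show "\<And>x y. x \<in> S \<inter> cball 0 r \<Longrightarrow> y \<in> S \<inter> cball 0 r \<Longrightarrow> dist (F x) (F y) \<le> q * dist x y"
      using contr by (auto simp: dist_norm)
  qed (use q0 self in auto)
  then obtain u where u: "u \<in> S" "norm u \<le> r" "F u = u" by auto
  then have "T u = 0" using t by (simp add: F_def)
  with u that show ?thesis by blast
qed

text \<open>With \<open>m\<close> the infimum of the Rayleigh quotient on \<open>M\<close>, the form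
  of \<open>T - m\<close> is nonnegative there, and Cauchy-Schwarz for this form turns a nearly
  minimal value at \<open>u\<close> into smallness of all pairings with \<open>M\<close>. Test
  vectors come from \<open>M\<close> alone, since \<open>M\<close> need not be invariant.\<close>

lemma approx_eigenvector:
  fixes T :: "'a::real_inner \<Rightarrow>\<^sub>L 'a"
  assumes T: "self_adjoint T" and M: "subspace M" and u0: "u0 \<in> M" "u0 \<noteq> 0"
    and le: "T u0 \<bullet> u0 \<le> k * (norm u0)\<^sup>2" and e: "e > 0"
  obtains m u where "m \<le> k" "u \<in> M" "norm u = 1"
    "\<And>v. v \<in> M \<Longrightarrow> \<bar>(T u - m *\<^sub>R u) \<bullet> v\<bar> \<le> e * norm v"
proof -
  define R where "R = (\<lambda>u. T u \<bullet> u) ` {u \<in> M. norm u = 1}"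
  have bnd: "\<bar>T u \<bullet> u\<bar> \<le> norm T * (norm u)\<^sup>2" for u
    using Cauchy_Schwarz_ineq2[of "T u" u] norm_blinfun[of T u]
    by (smt (verit) mult.assoc mult_right_mono norm_ge_zero power2_eq_square)
  have bb: "bdd_below R"
    unfolding R_def bdd_below_def
  proof (intro exI[of _ "- norm T"] ballI; elim imageE; clarify)
    fix u assume "u \<in> M" "norm u = 1"
    then show "- norm T \<le> T u \<bullet> u" using bnd[of u] by auto
  qed
  have u1: "T (sgn u0) \<bullet> sgn u0 \<in> R"
    unfolding R_def using u0 M
    by (intro imageI CollectI conjI) (auto simp: norm_sgn, simp add: sgn_div_norm subspace_scale)
  define m where "m = Inf R"
  have "m \<le> T (sgn u0) \<bullet> sgn u0" unfolding m_def using u1 bb by (rule cInf_lower)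
  also have "\<dots> = (T u0 \<bullet> u0) / (norm u0)\<^sup>2"
    by (simp add: sgn_div_norm blinfun.scaleR_right power2_eq_square divide_inverse)
  also have "\<dots> \<le> k" using le u0 by (simp add: divide_le_eq)
  finally have mk: "m \<le> k" .
  define b where "b u v = (T u - m *\<^sub>R u) \<bullet> v" for u v
  have b_nonneg: "b u u \<ge> 0" if "u \<in> M" for u
  proof (cases "u = 0")
    case False
    then have "T (sgn u) \<bullet> sgn u \<in> R"
      unfolding R_def using that M
      by (intro imageI CollectI conjI) (auto simp: norm_sgn, simp add: sgn_div_norm subspace_scale)
    then have "m \<le> T (sgn u) \<bullet> sgn u" unfolding m_def using bb by (rule cInf_lower)
    also have "\<dots> = (T u \<bullet> u) / (norm u)\<^sup>2"
      by (simp add: sgn_div_norm blinfun.scaleR_right power2_eq_square divide_inverse)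
    finally show ?thesis using False
      by (simp add: b_def inner_diff_left le_divide_eq power2_norm_eq_inner)
  qed (simp add: b_def)
  define K where "K = norm T + \<bar>m\<bar> + 1"
  have K: "K > 0" by (simp add: K_def add_nonneg_pos)
  have bK: "b v v \<le> K * (norm v)\<^sup>2" for v
  proof -
    have "b v v = T v \<bullet> v - m * (norm v)\<^sup>2"
      by (simp add: b_def inner_diff_left power2_norm_eq_inner)
    also have "\<dots> \<le> norm T * (norm v)\<^sup>2 + \<bar>m\<bar> * (norm v)\<^sup>2"
      using bnd[of v] mult_right_mono[of "-m" "\<bar>m\<bar>" "(norm v)\<^sup>2"]
      by (simp add: abs_ge_minus_self)
    also have "\<dots> \<le> K * (norm v)\<^sup>2" by (simp add: K_def algebra_simps)
    finally show ?thesis .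
  qed
  \<comment> \<open>The tolerance is chosen so that Cauchy-Schwarz, with the form bounded by
    \<open>K\<close>, yields (e^2 / K) * K = e^2.\<close>
  have "\<exists>x\<in>R. x < m + e\<^sup>2 / K"
    using cInf_less_iff[OF _ bb, of "m + e\<^sup>2 / K"] u1 e K by (auto simp: m_def)
  then obtain u where u: "u \<in> M" "norm u = 1" "T u \<bullet> u < m + e\<^sup>2 / K"
    by (auto simp: R_def)
  have buu: "b u u \<le> e\<^sup>2 / K"
    using u by (simp add: b_def inner_diff_left flip: power2_norm_eq_inner)
  have "\<bar>b u v\<bar> \<le> e * norm v" if v: "v \<in> M" for v
  proof (cases "v = 0")
    case False
    define k where "k = K * (norm v)\<^sup>2"
    have k: "k > 0" using False K by (simp add: k_def)
    \<comment> \<open>Minimiser of the quadratic in \<open>t\<close> after its leading coefficient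
      \<open>b v v\<close> is replaced by the upper bound \<open>k\<close>, which cannot
      vanish.\<close>
    define t where "t = - (b u v) / k"
    have sym: "b v u = b u v"
      using T by (simp add: b_def inner_diff_left self_adjoint_def) (simp add: inner_commute)
    have "0 \<le> b (u + t *\<^sub>R v) (u + t *\<^sub>R v)"
      using u v M by (intro b_nonneg) (simp add: subspace_add subspace_scale)
    also have "\<dots> = b u u + t * b u v + t * b v u + t\<^sup>2 * b v v"
      by (simp add: b_def blinfun.add_right blinfun.scaleR_right algebra_simps power2_eq_square)
    also have "\<dots> = b u u + 2 * t * b u v + t\<^sup>2 * b v v"
      by (simp add: sym)
    also have "\<dots> \<le> e\<^sup>2 / K + 2 * t * b u v + t\<^sup>2 * k"
      using mult_left_mono[OF bK[of v], of "t\<^sup>2"] buu by (simp add: k_def)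
    also have "\<dots> = e\<^sup>2 / K - (b u v)\<^sup>2 / k"
      using k by (simp add: t_def field_simps power2_eq_square)
    finally have "(b u v)\<^sup>2 \<le> (e * norm v)\<^sup>2"
      using k K False by (simp add: k_def field_simps)
    then show ?thesis using e by (metis abs_le_square_iff abs_mult abs_norm_cancel abs_of_pos)
  qed (simp add: b_def)
  then show ?thesis using that mk u by (simp add: b_def)
qed

section \<open>Finite orthonormal systems and limits of approximate eigenvectors\<close>

definition orthonormal :: "'a::real_inner set \<Rightarrow> bool" where
  "orthonormal E \<longleftrightarrow> (\<forall>e\<in>E. \<forall>e'\<in>E. e \<bullet> e' = (if e = e' then 1 else 0))"

definition proj :: "'a::real_inner set \<Rightarrow> 'a \<Rightarrow> 'a" where
  "proj E z = (\<Sum>e\<in>E. (z \<bullet> e) *\<^sub>R e)"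

lemma orthogonal_comp_iff: "z \<in> orthogonal_comp E \<longleftrightarrow> (\<forall>e\<in>E. z \<bullet> e = 0)"
  by (auto simp: orthogonal_comp_def orthogonal_def inner_commute)

lemma closed_orthogonal_comp: "closed (orthogonal_comp (E :: 'a::real_inner set))"
proof -
  have "orthogonal_comp E = (\<Inter>e\<in>E. {z. z \<bullet> e = 0})"
    by (auto simp: orthogonal_comp_iff)
  also have "closed \<dots>"
    by (intro closed_INT ballI closed_Collect_eq continuous_intros)
  finally show ?thesis .
qed

lemma proj_inner:
  assumes "orthonormal E" "finite E" "e \<in> E"
  shows "proj E z \<bullet> e = z \<bullet> e"
proof -
  have "proj E z \<bullet> e = (\<Sum>e'\<in>E. if e' = e then z \<bullet> e else 0)"
    unfolding proj_def inner_sum_left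
    using assms by (intro sum.cong) (auto simp: orthonormal_def)
  then show ?thesis using assms by simp
qed

lemma proj_in_span: "proj E z \<in> span E"
  unfolding proj_def by (intro span_sum span_scale span_base)

lemma diff_proj:
  assumes "orthonormal E" "finite E"
  shows "z - proj E z \<in> orthogonal_comp E"
  using assms by (simp add: orthogonal_comp_iff inner_diff_left proj_inner)

lemma orthogonal_comp_span:
  assumes "p \<in> orthogonal_comp E" "n \<in> span E"
  shows "p \<bullet> n = 0"
  using assms(2)
  by (induction rule: span_induct_alt)
     (use assms(1) in \<open>auto simp: orthogonal_comp_iff inner_right_distrib\<close>)

lemma bounded_linear_proj: "bounded_linear (proj E)"
  unfolding proj_def
  by (intro bounded_linear_sum bounded_linear_compose[OF bounded_linear_scaleR_left]
        bounded_linear_inner_left)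

lemma proj_unique:
  assumes E: "orthonormal E" "finite E" and "p \<in> orthogonal_comp E" "n \<in> span E"
  shows "proj E (p + n) = n"
proof -
  define d where "d = n - proj E (p + n)"
  have "d \<in> span E" using assms proj_in_span by (auto simp: d_def intro: span_diff)
  moreover have "d = (p + n - proj E (p + n)) - p" by (simp add: d_def)
  then have "d \<in> orthogonal_comp E"
    using diff_proj[OF E] assms(3) subspace_orthogonal_comp by (metis subspace_diff)
  ultimately have "d \<bullet> d = 0" by (rule orthogonal_comp_span[rotated])
  then show ?thesis by (simp add: d_def)
qed

lemma proj_norm:
  assumes "orthonormal E" "finite E"
  shows "(norm z)\<^sup>2 = (norm (z - proj E z))\<^sup>2 + (norm (proj E z))\<^sup>2"
proof -
  have "(z - proj E z) \<bullet> proj E z = 0"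
    by (rule orthogonal_comp_span[OF diff_proj[OF assms] proj_in_span])
  then have "(norm ((z - proj E z) + proj E z))\<^sup>2 = (norm (z - proj E z))\<^sup>2 + (norm (proj E z))\<^sup>2"
    unfolding power2_norm_eq_inner by (simp add: algebra_simps inner_commute)
  then show ?thesis by simp
qed

lemma square_sum_bounds:
  fixes a b c :: real
  assumes "a\<^sup>2 = b\<^sup>2 + c\<^sup>2" "a \<ge> 0"
  shows "b \<le> a" "c \<le> a"
  using assms by (auto intro!: power2_le_imp_le[of _ a])

lemma norm_proj_le: "orthonormal E \<Longrightarrow> finite E \<Longrightarrow> norm (proj E z) \<le> norm z"
  by (rule square_sum_bounds(2)[OF proj_norm norm_ge_zero])

lemma norm_diff_proj_le: "orthonormal E \<Longrightarrow> finite E \<Longrightarrow> norm (z - proj E z) \<le> norm z"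
  by (rule square_sum_bounds(1)[OF proj_norm norm_ge_zero])

lemma proj_span: "orthonormal E \<Longrightarrow> finite E \<Longrightarrow> n \<in> span E \<Longrightarrow> proj E n = n"
  using proj_unique[OF _ _ subspace_0[OF subspace_orthogonal_comp], of E n] by simp

lemma closed_span:
  assumes "orthonormal E" "finite E"
  shows "closed (span E)"
proof -
  have "span E = {z. proj E z = z}"
    using proj_span[OF assms] proj_in_span by (metis (mono_tags, lifting) Collect_cong Collect_mem_eq)
  moreover have "closed {z. proj E z = z}"
    by (intro closed_Collect_eq continuous_intros linear_continuous_on bounded_linear_proj)
  ultimately show ?thesis by simp
qed

text \<open>Strong compactness argument replacing weak limits: the operators \<open>P k - m k\<close> are uniformly
  bounded below, so a limit of \<open>(P k - m k) (u k)\<close> forces convergence of \<open>u k\<close> itself.\<close>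

lemma limit_eigenvector:
  fixes P Q :: "'a::{real_inner, complete_space} \<Rightarrow>\<^sub>L 'a" and Pk Qk :: "nat \<Rightarrow> 'a \<Rightarrow>\<^sub>L 'a"
  assumes P: "\<And>u. (\<lambda>k. Pk k u) \<longlonglongrightarrow> P u" and Q: "Qk \<longlonglongrightarrow> Q" and cQ: "compact_op Q"
    and C0: "C0 > 0" "\<And>k u. Pk k u \<bullet> u \<ge> C0 * (norm u)\<^sup>2"
    and sa: "\<And>k. self_adjoint (Pk k + Qk k)"
    and E: "orthonormal E" "finite E" "\<And>e. e \<in> E \<Longrightarrow> \<exists>l. (P + Q) e = l *\<^sub>R e"
    and u: "\<And>k. u k \<in> orthogonal_comp E" "\<And>k. norm (u k) = 1"
    and m: "\<And>k. m k \<le> r k" and r: "r \<longlonglongrightarrow> 0"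
    and approx: "\<And>k v. v \<in> orthogonal_comp E \<Longrightarrow>
      \<bar>((Pk k + Qk k) (u k) - m k *\<^sub>R u k) \<bullet> v\<bar> \<le> r k * norm v"
  obtains h l where "l \<le> 0" "h \<in> orthogonal_comp E" "norm h = 1" "(P + Q) h = l *\<^sub>R h"
proof -
  define w where "w k = (Pk k + Qk k) (u k) - m k *\<^sub>R u k" for k
  have r0: "r k \<ge> 0" for k
    using order_trans[OF abs_ge_zero approx[OF u(1)[of k], of k]] u(2)[of k] by simp
  \<comment> \<open>\<open>approx\<close> controls nothing along \<open>E\<close>. There
    self-adjointness moves the operator onto \<open>e\<close>; the multiple of \<open>e\<close> that
    is subtracted is orthogonal to \<open>u k\<close>, and strong convergence at the one vector
    \<open>e\<close> suffices.\<close>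
  have w_E: "(\<lambda>k. w k \<bullet> e) \<longlonglongrightarrow> 0" if e: "e \<in> E" for e
  proof -
    obtain l where l: "(P + Q) e = l *\<^sub>R e" using E(3)[OF e] by blast
    have ue: "u k \<bullet> e = 0" for k using u(1)[of k] e by (simp add: orthogonal_comp_iff)
    have "w k \<bullet> e = u k \<bullet> ((Pk k + Qk k) e - (P + Q) e)" for k
      using sa[of k] ue[of k] unfolding l self_adjoint_def
      by (simp add: w_def inner_diff_left inner_diff_right)
    then have "\<bar>w k \<bullet> e\<bar> \<le> norm ((Pk k + Qk k) e - (P + Q) e)" for k
      using Cauchy_Schwarz_ineq2[of "u k" "(Pk k + Qk k) e - (P + Q) e"] u(2)[of k] by simp
    moreover have "(\<lambda>k. (Pk k + Qk k) e - (P + Q) e) \<longlonglongrightarrow> 0"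
      unfolding blinfun.add_left LIM_zero_iff
      by (intro tendsto_add P blinfun.tendsto[OF Q] tendsto_const)
    then have "(\<lambda>k. norm ((Pk k + Qk k) e - (P + Q) e)) \<longlonglongrightarrow> 0"
      by (rule tendsto_norm_zero)
    ultimately show ?thesis
      by (intro Lim_null_comparison[of "\<lambda>k. w k \<bullet> e"]) auto
  qed
  have w_M: "norm (w k - proj E (w k)) \<le> r k" for k
  proof -
    let ?p = "w k - proj E (w k)"
    have p: "?p \<in> orthogonal_comp E" by (rule diff_proj[OF E(1,2)])
    have "proj E (w k) \<bullet> ?p = 0"
      using orthogonal_comp_span[OF p proj_in_span, of "w k"] by (simp add: inner_commute)
    then have "(norm ?p)\<^sup>2 = w k \<bullet> ?p" by (simp add: power2_norm_eq_inner inner_diff_left)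
    also have "\<dots> \<le> r k * norm ?p" using approx[OF p, of k] by (simp add: w_def)
    finally show ?thesis using r0[of k]
      by (cases "norm ?p = 0") (auto simp: power2_eq_square)
  qed
  have w0: "w \<longlonglongrightarrow> 0"
  proof -
    have "(\<lambda>k. w k - proj E (w k)) \<longlonglongrightarrow> 0"
      by (rule Lim_null_comparison[OF _ r]) (use w_M in auto)
    moreover have "(\<lambda>k. proj E (w k)) \<longlonglongrightarrow> (\<Sum>e\<in>E. 0 *\<^sub>R e)"
      unfolding proj_def by (intro tendsto_sum tendsto_scaleR w_E tendsto_const)
    ultimately have "(\<lambda>k. w k - proj E (w k) + proj E (w k)) \<longlonglongrightarrow> 0 + (\<Sum>e\<in>E. 0 *\<^sub>R e)"
      by (rule tendsto_add)
    then show ?thesis by simp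
  qed
  obtain R where R: "\<And>k. r k \<le> R"
    using convergent_imp_bounded[OF r] r0
    by (auto simp: bounded_iff)
  obtain K where K: "\<And>k. norm (Qk k) \<le> K"
    using convergent_imp_bounded[OF Q] by (auto simp: bounded_iff)
  \<comment> \<open>The \<open>Pk\<close> part cannot lower the Rayleigh quotient; only the bounded
    \<open>Qk\<close> and the error can. Thus \<open>m\<close> stays in a compact interval.\<close>
  have m_lower: "m k \<ge> - K - R" for k
  proof -
    have "\<bar>(Pk k + Qk k) (u k) \<bullet> u k - m k\<bar> \<le> r k"
      using approx[OF u(1)[of k], of k] u(2)[of k]
      by (simp add: inner_diff_left flip: power2_norm_eq_inner)
    moreover have "Pk k (u k) \<bullet> u k \<ge> 0"
      using C0(2)[of "u k" k] C0(1) u(2)[of k] by simp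
    moreover have "\<bar>Qk k (u k) \<bullet> u k\<bar> \<le> K"
      using Cauchy_Schwarz_ineq2[of "Qk k (u k)" "u k"] norm_blinfun[of "Qk k" "u k"] K[of k] u(2)[of k]
      by auto
    ultimately show ?thesis using R[of k] by (simp add: blinfun.add_left inner_add_left)
  qed
  let ?C = "{-K - R..R} \<times> closure (Q ` cball 0 1)"
  have C: "compact ?C" using cQ by (auto intro!: compact_Times simp: compact_op_def)
  have "(m k, Q (u k)) \<in> ?C" for k
    using m_lower[of k] m[of k] R[of k] u(2)[of k]
    by (auto intro!: closure_subset[THEN subsetD] imageI)
  then obtain lz s where s: "strict_mono s" "((\<lambda>k. (m k, Q (u k))) \<circ> s) \<longlonglongrightarrow> lz"
    using C[unfolded compact_def, rule_format, of "\<lambda>k. (m k, Q (u k))"] by blast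
  obtain l z where lz: "lz = (l, z)" by (cases lz)
  have ml: "(\<lambda>k. m (s k)) \<longlonglongrightarrow> l" and Qz: "(\<lambda>k. Q (u (s k))) \<longlonglongrightarrow> z"
    using tendsto_fst[OF s(2)] tendsto_snd[OF s(2)] by (simp_all add: lz o_def)
  have sub: "(\<lambda>k. f (s k)) \<longlonglongrightarrow> c" if "f \<longlonglongrightarrow> c" for f and c :: "'b::topological_space"
    using LIMSEQ_subseq_LIMSEQ[OF that s(1)] by (simp add: o_def)
  have l0: "l \<le> 0"
    by (rule LIMSEQ_le[OF ml sub[OF r]]) (use m in auto)
  \<comment> \<open>The residual \<open>w\<close> tends to 0, so the \<open>P\<close> part has the
    same limit as minus the \<open>Q\<close> part, and that one converges by compactness.\<close>
  have y: "(\<lambda>k. Pk (s k) (u (s k)) - m (s k) *\<^sub>R u (s k)) \<longlonglongrightarrow> - z"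
  proof -
    have "(\<lambda>k. (Qk (s k) - Q) (u (s k))) \<longlonglongrightarrow> 0"
    proof (rule Lim_null_comparison)
      show "(\<lambda>k. norm (Qk (s k) - Q)) \<longlonglongrightarrow> 0"
        using sub[OF Q] by (simp add: LIM_zero tendsto_norm_zero)
      show "\<forall>\<^sub>F k in sequentially. norm ((Qk (s k) - Q) (u (s k))) \<le> norm (Qk (s k) - Q)"
        by (intro always_eventually allI order_trans[OF norm_blinfun]) (simp add: u(2))
    qed
    from tendsto_diff[OF tendsto_diff[OF sub[OF w0] this] Qz]
    show ?thesis
      by (simp add: w_def blinfun.add_left blinfun.diff_left algebra_simps)
  qed
  have PC: "P v \<bullet> v \<ge> C0 * (norm v)\<^sup>2" for v
    by (rule LIMSEQ_le_const[OF tendsto_inner[OF P tendsto_const]]) (use C0 in auto)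
  \<comment> \<open>The candidate for the limit of \<open>u\<close> is defined by an equation:
    \<open>P - l\<close> is strongly monotone as \<open>l\<close> is at most 0, and the radius meets
    the size condition at the origin with equality.\<close>
  obtain h where h: "P h - l *\<^sub>R h + z = 0"
  proof (rule strongly_monotone_zero[of UNIV "2 * norm z / C0" C0 "\<lambda>v. P v - l *\<^sub>R v + z" "norm P + \<bar>l\<bar>"])
    fix x y :: 'a
    have eq: "P x - l *\<^sub>R x + z - (P y - l *\<^sub>R y + z) = P (x - y) - l *\<^sub>R (x - y)"
      by (simp add: blinfun.diff_right algebra_simps)
    have "l * ((x - y) \<bullet> (x - y)) \<le> 0" using l0 by (intro mult_nonpos_nonneg) auto
    then show "C0 * (norm (x - y))\<^sup>2 \<le> (P x - l *\<^sub>R x + z - (P y - l *\<^sub>R y + z)) \<bullet> (x - y)"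
      unfolding eq using PC[of "x - y"] by (simp only: inner_diff_left inner_scaleR_left)
    show "norm (P x - l *\<^sub>R x + z - (P y - l *\<^sub>R y + z)) \<le> (norm P + \<bar>l\<bar>) * norm (x - y)"
      unfolding eq using norm_triangle_ineq4[of "P (x - y)" "l *\<^sub>R (x - y)"] norm_blinfun[of P "x - y"]
      by (simp add: distrib_right)
  qed (use C0 in \<open>auto simp: field_simps\<close>)
  have "(\<lambda>k. Pk (s k) h - m (s k) *\<^sub>R h) \<longlonglongrightarrow> P h - l *\<^sub>R h"
    by (intro tendsto_intros ml sub[OF P])
  from tendsto_diff[OF y this] have
    v0: "(\<lambda>k. Pk (s k) (u (s k)) - m (s k) *\<^sub>R u (s k) - (Pk (s k) h - m (s k) *\<^sub>R h)) \<longlonglongrightarrow> 0"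
    using h by (simp add: algebra_simps eq_neg_iff_add_eq_0)
  have "(\<lambda>k. u (s k) - h) \<longlonglongrightarrow> 0"
  proof (rule Lim_null_comparison)
    show "\<forall>\<^sub>F k in sequentially. norm (u (s k) - h) \<le>
      norm (Pk (s k) (u (s k)) - m (s k) *\<^sub>R u (s k) - (Pk (s k) h - m (s k) *\<^sub>R h)) / (C0 / 2)"
    proof -
      \<comment> \<open>\<open>m\<close> may be slightly positive along the sequence; half of
        \<open>C0\<close> absorbs this.\<close>
      have "\<forall>\<^sub>F k in sequentially. r (s k) < C0 / 2"
        by (rule order_tendstoD(2)[OF sub[OF r]]) (use C0 in auto)
      then show ?thesis
      proof eventually_elim
        case (elim k)
        define d where "d = u (s k) - h"
        define v where "v = Pk (s k) (u (s k)) - m (s k) *\<^sub>R u (s k) - (Pk (s k) h - m (s k) *\<^sub>R h)"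
        have v: "v = Pk (s k) d - m (s k) *\<^sub>R d"
          by (simp add: v_def d_def blinfun.diff_right algebra_simps)
        have "m (s k) * (norm d)\<^sup>2 \<le> C0 / 2 * (norm d)\<^sup>2"
          using elim m[of "s k"] by (intro mult_right_mono) auto
        then have "C0 / 2 * (norm d)\<^sup>2 \<le> v \<bullet> d"
          using C0(2)[of d "s k"] unfolding v by (simp add: inner_diff_left power2_norm_eq_inner)
        also have "\<dots> \<le> norm v * norm d" by (rule norm_cauchy_schwarz)
        finally have "C0 / 2 * norm d \<le> norm v"
          by (cases "d = 0") (auto simp: power2_eq_square)
        then show ?case using C0 unfolding d_def[symmetric] v_def[symmetric] by (simp add: field_simps)
      qed
    qed
    show "(\<lambda>k. norm (Pk (s k) (u (s k)) - m (s k) *\<^sub>R u (s k) - (Pk (s k) h - m (s k) *\<^sub>R h)) / (C0 / 2)) \<longlonglongrightarrow> 0"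
      using tendsto_divide[OF tendsto_norm_zero[OF v0] tendsto_const[of "C0 / 2"]] C0 by simp
  qed
  then have uh: "(\<lambda>k. u (s k)) \<longlonglongrightarrow> h" by (simp add: LIM_zero_iff)
  have "z = Q h" using LIMSEQ_unique[OF Qz blinfun.tendsto[OF tendsto_const uh]] .
  then have "(P + Q) h = l *\<^sub>R h" using h by (simp add: blinfun.add_left algebra_simps eq_neg_iff_add_eq_0)
  moreover have "h \<in> orthogonal_comp E"
    using closed_sequentially[OF closed_orthogonal_comp _ uh] u(1) by blast
  moreover have "norm h = 1"
    using LIMSEQ_unique[OF tendsto_norm[OF uh], of 1] u(2) by simp
  ultimately show ?thesis using that l0 by blast
qed

section \<open>The negative and positive spaces\<close>

text \<open>For the difference d of two orthonormal eigenvectors, the form of \<open>P + Q\<close>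
  is the sum of their eigenvalues, hence non-positive, and the lower bound on \<open>P\<close>
  forces norm (Q d) to be at least C0 * norm d. In an infinite family compactness of
  \<open>Q\<close> gives two members whose images are closer than \<open>C0\<close>, although d has
  norm sqrt 2.\<close>

lemma finite_nonpos_eigenvectors:
  fixes P Q :: "'a::real_inner \<Rightarrow>\<^sub>L 'a"
  assumes cQ: "compact_op Q" and C0: "C0 > 0" "\<And>u. P u \<bullet> u \<ge> C0 * (norm u)\<^sup>2"
    and E: "orthonormal E" "\<And>e. e \<in> E \<Longrightarrow> \<exists>l\<le>0. (P + Q) e = l *\<^sub>R e"
  shows "finite E"
proof (rule ccontr)
  assume "infinite E"
  then obtain f :: "nat \<Rightarrow> 'a" where f: "inj f" "range f \<subseteq> E"
    using infinite_countable_subset by blast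
  have nf: "norm (f n) = 1" for n
    using E(1) rangeI[of f n] f(2) by (simp add: orthonormal_def norm_eq_sqrt_inner subset_eq)
  have "compact (closure (Q ` cball 0 1))" using cQ by (simp add: compact_op_def)
  moreover have "Q (f n) \<in> closure (Q ` cball 0 1)" for n
    using nf[of n] by (auto intro!: closure_subset[THEN subsetD] imageI)
  ultimately obtain l s where s: "strict_mono s" "((\<lambda>n. Q (f n)) \<circ> s) \<longlonglongrightarrow> l"
    unfolding compact_def by (elim allE[where x="\<lambda>n. Q (f n)"]) blast
  then have "Cauchy ((\<lambda>n. Q (f n)) \<circ> s)" by (intro LIMSEQ_imp_Cauchy)
  then obtain M where M: "\<And>m n. m \<ge> M \<Longrightarrow> n \<ge> M \<Longrightarrow> dist (Q (f (s m))) (Q (f (s n))) < C0"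
    using C0(1) unfolding Cauchy_def o_def by blast
  define a b where "a = f (s M)" and "b = f (s (Suc M))"
  define d where "d = a - b"
  have "s M < s (Suc M)" using s(1) by (simp add: strict_mono_Suc_iff)
  then have ne: "a \<noteq> b" using f(1) by (metis a_def b_def injD less_irrefl)
  have abE: "a \<in> E" "b \<in> E" using f by (auto simp: a_def b_def)
  then have ab: "a \<bullet> b = 0" "b \<bullet> a = 0" "a \<bullet> a = 1" "b \<bullet> b = 1"
    using E(1) ne by (auto simp: orthonormal_def)
  obtain la lb where l: "la \<le> 0" "lb \<le> 0" "(P + Q) a = la *\<^sub>R a" "(P + Q) b = lb *\<^sub>R b"
    using E(2) abE by meson
  have "(P + Q) d \<bullet> d = la + lb"
    unfolding d_def blinfun.diff_right l using ab by (simp add: algebra_simps)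
  then have "P d \<bullet> d \<le> - (Q d \<bullet> d)" using l by (simp add: blinfun.add_left inner_add_left)
  also have "\<dots> \<le> norm (Q d) * norm d" using Cauchy_Schwarz_ineq2[of "Q d" d] by linarith
  finally have "C0 * (norm d)\<^sup>2 \<le> norm (Q d) * norm d" using C0(2)[of d] by linarith
  then have "C0 * norm d \<le> norm (Q d)"
    using ne by (simp add: d_def power2_eq_square)
  moreover have "(norm d)\<^sup>2 = 2"
    unfolding power2_norm_eq_inner d_def using ab by (simp add: algebra_simps)
  then have "norm d \<ge> 1" by (intro power2_le_imp_le[of 1]) auto
  then have "C0 \<le> C0 * norm d" using C0(1) by simp
  moreover have "norm (Q d) < C0"
    using M[of M "Suc M"] by (simp add: d_def a_def b_def dist_norm blinfun.diff_right)
  ultimately show False by linarith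
qed

text \<open>A maximal orthonormal family of negative eigenvectors does it. If the form failed to be
  positive on the complement, \<open>limit_eigenvector\<close> for constant sequences of operators
  would give a unit eigenvector there with eigenvalue at most 0; the trivial kernel makes it
  negative, against maximality. Finiteness is settled first because the limit argument uses
  it.\<close>

lemma negative_eigenbasis:
  fixes P Q :: "'a::{real_inner, complete_space} \<Rightarrow>\<^sub>L 'a"
  assumes cQ: "compact_op Q" and C0: "C0 > 0" "\<And>u. P u \<bullet> u \<ge> C0 * (norm u)\<^sup>2"
    and sa: "self_adjoint (P + Q)" and ker: "\<And>u. (P + Q) u = 0 \<Longrightarrow> u = 0"
  obtains E where "orthonormal E" "finite E" "\<And>e. e \<in> E \<Longrightarrow> \<exists>l<0. (P + Q) e = l *\<^sub>R e"
    "\<And>u. u \<in> orthogonal_comp E \<Longrightarrow> u \<noteq> 0 \<Longrightarrow> (P + Q) u \<bullet> u > 0"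
proof -
  define F where "F = {E. orthonormal E \<and> (\<forall>e\<in>E. \<exists>l<0. (P + Q) e = l *\<^sub>R e)}"
  have "\<exists>E\<in>F. \<forall>Y\<in>F. E \<subseteq> Y \<longrightarrow> Y = E"
  proof (rule subset_Zorn')
    fix C assume C: "subset.chain F C"
    have "orthonormal (\<Union>C)"
      unfolding orthonormal_def
    proof (intro ballI)
      fix e e' assume "e \<in> \<Union>C" "e' \<in> \<Union>C"
      then obtain Y where "Y \<in> C" "e \<in> Y" "e' \<in> Y"
        using C unfolding subset_chain_def by blast
      then show "e \<bullet> e' = (if e = e' then 1 else 0)"
        using C unfolding subset_chain_def F_def orthonormal_def by blast
    qed
    moreover have "\<forall>e\<in>\<Union>C. \<exists>l<0. (P + Q) e = l *\<^sub>R e"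
      using C unfolding subset_chain_def F_def by blast
    ultimately show "\<Union>C \<in> F" by (simp add: F_def)
  qed
  then obtain E where E: "E \<in> F" and max: "\<And>Y. Y \<in> F \<Longrightarrow> E \<subseteq> Y \<Longrightarrow> Y = E" by blast
  have on: "orthonormal E" and ev: "\<And>e. e \<in> E \<Longrightarrow> \<exists>l<0. (P + Q) e = l *\<^sub>R e"
    using E by (auto simp: F_def)
  have fin: "finite E"
    by (rule finite_nonpos_eigenvectors[OF cQ C0 on]) (use ev less_imp_le in blast)
  have "(P + Q) u \<bullet> u > 0" if u: "u \<in> orthogonal_comp E" "u \<noteq> 0" for u
  proof (rule ccontr)
    assume "\<not> (P + Q) u \<bullet> u > 0"
    then have le: "(P + Q) u \<bullet> u \<le> 0 * (norm u)\<^sup>2" by simp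
    have "\<forall>k. \<exists>m w. m \<le> 0 \<and> w \<in> orthogonal_comp E \<and> norm w = 1 \<and>
      (\<forall>v\<in>orthogonal_comp E. \<bar>((P + Q) w - m *\<^sub>R w) \<bullet> v\<bar> \<le> inverse (real (Suc k)) * norm v)"
    proof
      fix k
      show "\<exists>m w. m \<le> 0 \<and> w \<in> orthogonal_comp E \<and> norm w = 1 \<and>
        (\<forall>v\<in>orthogonal_comp E. \<bar>((P + Q) w - m *\<^sub>R w) \<bullet> v\<bar> \<le> inverse (real (Suc k)) * norm v)"
        by (rule approx_eigenvector[OF sa subspace_orthogonal_comp u le, of "inverse (real (Suc k))"])
           (simp, blast)
    qed
    then obtain m w where mw: "\<And>k. m k \<le> 0" "\<And>k. w k \<in> orthogonal_comp E" "\<And>k. norm (w k) = 1"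
      "\<And>k v. v \<in> orthogonal_comp E \<Longrightarrow>
        \<bar>((P + Q) (w k) - m k *\<^sub>R w k) \<bullet> v\<bar> \<le> inverse (real (Suc k)) * norm v"
      by metis
    have mr: "m k \<le> inverse (real (Suc k))" for k
      using mw(1)[of k] by (rule order_trans) simp
    have ev': "\<exists>l. (P + Q) e = l *\<^sub>R e" if "e \<in> E" for e using ev[OF that] by blast
    obtain h l where h: "l \<le> 0" "h \<in> orthogonal_comp E" "norm h = 1" "(P + Q) h = l *\<^sub>R h"
      using limit_eigenvector[OF tendsto_const tendsto_const cQ C0 sa on fin ev' mw(2,3) mr
          LIMSEQ_inverse_real_of_nat mw(4)] by blast
    have "l \<noteq> 0" using ker[of h] h by auto
    with h have l: "l < 0" by simp
    have "h \<bullet> h = 1" using h(3) by (simp flip: power2_norm_eq_inner)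
    moreover have "\<And>e. e \<in> E \<Longrightarrow> h \<bullet> e = 0" "\<And>e. e \<in> E \<Longrightarrow> e \<bullet> h = 0"
      using h(2) by (auto simp: orthogonal_comp_iff inner_commute)
    ultimately have "insert h E \<in> F"
      using on ev h(4) l by (auto simp: F_def orthonormal_def)
    then have "h \<in> E" using max by blast
    with h(2) \<open>h \<bullet> h = 1\<close> show False by (auto simp: orthogonal_comp_iff)
  qed
  with that on fin ev show ?thesis by blast
qed

lemma eigenbasis_comp_invariant:
  assumes "self_adjoint T" "\<And>e. e \<in> E \<Longrightarrow> \<exists>l. blinfun_apply T e = l *\<^sub>R e"
    "u \<in> orthogonal_comp E"
  shows "T u \<in> orthogonal_comp E"
  unfolding orthogonal_comp_iff
proof
  fix e assume e: "e \<in> E"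
  then obtain l where "T e = l *\<^sub>R e" using assms(2) by blast
  then show "T u \<bullet> e = 0"
    using assms e by (simp add: self_adjoint_def orthogonal_comp_iff)
qed

lemma eigenbasis_span_invariant:
  assumes "\<And>e. e \<in> E \<Longrightarrow> \<exists>l. blinfun_apply T e = l *\<^sub>R e" "u \<in> span E"
  shows "T u \<in> span E"
  using assms(2)
proof (induction rule: span_induct_alt)
  case base
  then show ?case by (simp add: span_zero)
next
  case (step c x y)
  then obtain l where "T x = l *\<^sub>R x" using assms(1) by blast
  with step show ?case
    by (simp add: blinfun.add_right blinfun.scaleR_right span_add span_scale span_base)
qed

lemma eigenbasis_negative:
  fixes T :: "'a::real_inner \<Rightarrow>\<^sub>L 'a"
  assumes E: "orthonormal E" "finite E" and ev: "\<And>e. e \<in> E \<Longrightarrow> \<exists>l<0. T e = l *\<^sub>R e"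
  obtains c where "c > 0" "\<And>u. u \<in> span E \<Longrightarrow> T u \<bullet> u \<le> - c * (norm u)\<^sup>2"
proof -
  obtain l where l: "\<And>e. e \<in> E \<Longrightarrow> l e < 0" "\<And>e. e \<in> E \<Longrightarrow> T e = l e *\<^sub>R e"
    using ev by metis
  \<comment> \<open>The extra 1 keeps the minimum defined and positive when \<open>E\<close> is
    empty, that is, when there is no negative direction.\<close>
  define c where "c = Min (insert 1 ((\<lambda>e. - l e) ` E))"
  have c: "c > 0" using E l by (auto simp: c_def)
  have le: "l e \<le> - c" if "e \<in> E" for e
  proof -
    have "c \<le> - l e" unfolding c_def using E that by (intro Min_le) auto
    then show ?thesis by simp
  qed
  have "T u \<bullet> u \<le> - c * (norm u)\<^sup>2" if u: "u \<in> span E" for u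
  proof -
    have u_eq: "u = (\<Sum>e\<in>E. (u \<bullet> e) *\<^sub>R e)"
      using proj_span[OF E u] by (simp add: proj_def)
    have "T u = (\<Sum>e\<in>E. (u \<bullet> e) *\<^sub>R l e *\<^sub>R e)"
      by (subst u_eq) (simp add: blinfun.sum_right blinfun.scaleR_right l)
    then have "T u \<bullet> u = (\<Sum>e\<in>E. l e * (u \<bullet> e)\<^sup>2)"
      by (simp add: inner_sum_left power2_eq_square)
         (simp add: inner_commute[of _ u] ac_simps)
    also have "\<dots> \<le> (\<Sum>e\<in>E. - c * (u \<bullet> e)\<^sup>2)"
      by (intro sum_mono mult_right_mono le) auto
    also have "\<dots> = - c * (\<Sum>e\<in>E. (u \<bullet> e)\<^sup>2)" by (simp add: sum_distrib_left sum_negf)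
    also have "(\<Sum>e\<in>E. (u \<bullet> e)\<^sup>2) = proj E u \<bullet> u"
      by (simp add: proj_def inner_sum_left power2_eq_square)
         (simp add: inner_commute[of _ u])
    also have "\<dots> = (norm u)\<^sup>2" using proj_span[OF E u] by (simp add: power2_norm_eq_inner)
    finally show ?thesis .
  qed
  with c that show ?thesis by blast
qed

text \<open>\<open>neg_space\<close> is a union, so every admissible \<open>S\<close> has to be
  shown to lie in \<open>span E\<close>, although \<open>S\<close> is not known to split along the
  eigenvectors. Once all of these are removed, the rest lies both in \<open>S\<close> and in the
  complement, where a nonzero vector would give the form both signs.\<close>

lemma neg_space_eq:
  fixes T :: "'a::real_inner \<Rightarrow>\<^sub>L 'a"
  assumes E: "orthonormal E" "finite E" and sa: "self_adjoint T"
    and ev: "\<And>e. e \<in> E \<Longrightarrow> \<exists>l<0. T e = l *\<^sub>R e"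
    and pos: "\<And>u. u \<in> orthogonal_comp E \<Longrightarrow> u \<noteq> 0 \<Longrightarrow> T u \<bullet> u > 0"
  shows "neg_space T = span E"
proof (intro equalityI subsetI)
  fix u assume "u \<in> neg_space T"
  then obtain S where S: "subspace S" "T ` S \<subseteq> S" "\<And>u. u \<in> S \<Longrightarrow> u \<noteq> 0 \<Longrightarrow> T u \<bullet> u < 0"
    and u: "u \<in> S" by (auto simp: neg_space_def)
  text \<open>Applying \<open>T - l\<close> for an eigenvalue \<open>l\<close> removes one eigenvector from the negative part of
    an element of \<open>S\<close>, and it is injective on the positive part.\<close>
  have key: "p = 0" if "finite F" "F \<subseteq> E" "n + p \<in> S" "n \<in> span F" "p \<in> orthogonal_comp E" for F n p
    using that
  proof (induction F arbitrary: n p rule: finite_induct)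
    case empty
    then have "p \<in> S" by simp
    then show ?case using S(3) pos empty.prems by (metis less_asym)
  next
    case (insert e F)
    obtain l where l: "l < 0" "T e = l *\<^sub>R e" using ev insert.prems by auto
    obtain k where k: "n - k *\<^sub>R e \<in> span F" using insert.prems by (auto simp: span_insert)
    have "T (n - k *\<^sub>R e) \<in> span F"
      using k by (intro eigenbasis_span_invariant) (use ev insert.prems in blast)+
    then have n': "T n - l *\<^sub>R n \<in> span F"
      using span_diff[OF _ span_scale[OF k, of l], of "T (n - k *\<^sub>R e)"] l(2)
      by (simp add: blinfun.diff_right blinfun.scaleR_right algebra_simps)
    have p': "T p - l *\<^sub>R p \<in> orthogonal_comp E"
      using insert.prems eigenbasis_comp_invariant[OF sa, of E p] ev
      by (intro subspace_diff subspace_scale subspace_orthogonal_comp) blast+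
    have "T (n + p) - l *\<^sub>R (n + p) \<in> S"
      using S insert.prems by (intro subspace_diff subspace_scale) auto
    then have "(T n - l *\<^sub>R n) + (T p - l *\<^sub>R p) \<in> S"
      by (simp add: blinfun.add_right algebra_simps)
    then have "T p - l *\<^sub>R p = 0" using insert.IH n' p' insert.prems by blast
    then have "T p \<bullet> p = l * (p \<bullet> p)" by simp
    also have "\<dots> \<le> 0" using l(1) by (intro mult_nonpos_nonneg) auto
    finally show ?case using pos insert.prems by (meson not_less)
  qed
  have "u - proj E u = 0"
    by (rule key[of E "proj E u"]) (use E u proj_in_span diff_proj[OF E] in auto)
  then show "u \<in> span E" using proj_in_span[of E u] by simp
next
  fix u assume u: "u \<in> span E"
  obtain c where c: "c > 0" "\<And>u. u \<in> span E \<Longrightarrow> T u \<bullet> u \<le> - c * (norm u)\<^sup>2"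
    using eigenbasis_negative[OF E ev] by blast
  have "closed (span E)" by (rule closed_span[OF E])
  moreover have "T ` span E \<subseteq> span E"
    using eigenbasis_span_invariant[of E T] ev by blast
  moreover have "T w \<bullet> w < 0" if "w \<in> span E" "w \<noteq> 0" for w
  proof -
    have "- c * (norm w)\<^sup>2 < 0" using c that by simp
    then show ?thesis using c(2)[OF that(1)] by linarith
  qed
  ultimately show "u \<in> neg_space T" using u by (auto simp: neg_space_def intro!: exI[of _ "span E"])
qed

text \<open>On an admissible \<open>S\<close> the form of \<open>T\<close> is nonnegative, so for a
  negative eigenvalue \<open>l\<close> the operator \<open>T - l\<close> is strongly monotone with
  constant \<open>- l\<close>; as \<open>S\<close> is closed, it is onto \<open>S\<close>. This
  takes the place of spectral projections.\<close>

lemma pos_space_eq: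
  fixes T :: "'a::{real_inner, complete_space} \<Rightarrow>\<^sub>L 'a"
  assumes sa: "self_adjoint T"
    and ev: "\<And>e. e \<in> E \<Longrightarrow> \<exists>l<0. T e = l *\<^sub>R e"
    and pos: "\<And>u. u \<in> orthogonal_comp E \<Longrightarrow> u \<noteq> 0 \<Longrightarrow> T u \<bullet> u > 0"
  shows "pos_space T = orthogonal_comp E"
proof (intro equalityI subsetI)
  fix u assume "u \<in> pos_space T"
  then obtain S where S: "subspace S" "closed S" "T ` S \<subseteq> S"
    "\<And>u. u \<in> S \<Longrightarrow> u \<noteq> 0 \<Longrightarrow> T u \<bullet> u > 0"
    and u: "u \<in> S" by (auto simp: pos_space_def)
  show "u \<in> orthogonal_comp E"
    unfolding orthogonal_comp_iff
  proof
    fix e assume e: "e \<in> E"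
    then obtain l where l: "l < 0" "T e = l *\<^sub>R e" using ev by blast
    text \<open>\<open>T - l\<close> maps \<open>S\<close> onto itself, and its range is orthogonal to \<open>e\<close>.\<close>
    obtain w where w: "w \<in> S" "T w - l *\<^sub>R w - u = 0"
    proof (rule strongly_monotone_zero[of S "2 * norm u / (-l)" "-l" "\<lambda>w. T w - l *\<^sub>R w - u" "norm T + \<bar>l\<bar>"])
      fix x assume "x \<in> S"
      then show "T x - l *\<^sub>R x - u \<in> S"
        using S u by (intro subspace_diff subspace_scale) auto
    next
      fix x y assume xy: "x \<in> S" "y \<in> S"
      have eq: "T x - l *\<^sub>R x - u - (T y - l *\<^sub>R y - u) = T (x - y) - l *\<^sub>R (x - y)"
        by (simp add: blinfun.diff_right algebra_simps)
      have "x - y \<in> S" using xy S by (simp add: subspace_diff)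
      then have "T (x - y) \<bullet> (x - y) \<ge> 0"
        using S(4) by (cases "x - y = 0") (auto intro: less_imp_le)
      then show "- l * (norm (x - y))\<^sup>2 \<le> (T x - l *\<^sub>R x - u - (T y - l *\<^sub>R y - u)) \<bullet> (x - y)"
        unfolding eq by (simp only: inner_diff_left inner_scaleR_left power2_norm_eq_inner)
      show "norm (T x - l *\<^sub>R x - u - (T y - l *\<^sub>R y - u)) \<le> (norm T + \<bar>l\<bar>) * norm (x - y)"
        unfolding eq using norm_triangle_ineq4[of "T (x - y)" "l *\<^sub>R (x - y)"] norm_blinfun[of T "x - y"]
        by (simp add: distrib_right)
    qed (use l S in \<open>auto simp: field_simps\<close>)
    then have "u = T w - l *\<^sub>R w" by simp
    then show "u \<bullet> e = 0"
      using sa l by (simp add: self_adjoint_def inner_diff_left)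
  qed
next
  fix u assume u: "u \<in> orthogonal_comp E"
  have "T ` orthogonal_comp E \<subseteq> orthogonal_comp E"
    using eigenbasis_comp_invariant[OF sa, of E] ev by blast
  then show "u \<in> pos_space T"
    using u pos closed_orthogonal_comp[of E] subspace_orthogonal_comp[of E]
    by (auto simp: pos_space_def intro!: exI[of _ "orthogonal_comp E"])
qed

section \<open>Radial coordinates\<close>

lemma sgn_sgn: "sgn (sgn x) = sgn (x :: 'a::real_normed_vector)"
  by (cases "x = 0") (simp_all add: sgn_div_norm)

lemma norm_scaleR_sgn: "norm x *\<^sub>R sgn x = (x :: 'a::real_normed_vector)"
  by (cases "x = 0") (simp_all add: sgn_div_norm)

text \<open>The parameter \<open>p\<close> lets one construction serve both the rescaling of
  \<open>M\<close> and the rescaling of the fibre over each \<open>x\<close>, jointly continuously.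
  Growth along rays makes \<open>sqrt (f p w)\<close> usable as a new radius in the direction of
  \<open>w\<close>.\<close>

locale radial =
  fixes A :: "'p::topological_space set" and S :: "'b::real_normed_vector set"
    and f :: "'p \<Rightarrow> 'b \<Rightarrow> real" and c r :: real
  assumes S: "subspace S" and c: "c > 0" and r: "r > 0"
    and cont: "continuous_on (A \<times> (S \<inter> ball 0 r)) (\<lambda>(p, w). f p w)"
    and zero: "\<And>p. p \<in> A \<Longrightarrow> f p 0 = 0"
    and coercive: "\<And>p w. \<lbrakk>p \<in> A; w \<in> S; norm w < r\<rbrakk> \<Longrightarrow> c * (norm w)\<^sup>2 \<le> f p w"
    and strict: "\<And>p w t. \<lbrakk>p \<in> A; w \<in> S; w \<noteq> 0; 1 < t; norm (t *\<^sub>R w) < r\<rbrakk>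
      \<Longrightarrow> f p w < f p (t *\<^sub>R w)"
begin

definition rad :: "'p \<Rightarrow> 'b \<Rightarrow> 'b" where
  "rad p w = sqrt (f p w) *\<^sub>R sgn w"

text \<open>At \<open>v = 0\<close> every radius in [0, r) qualifies, because
  \<open>sgn 0 = 0\<close> and \<open>f p 0 = 0\<close>; the choice is then arbitrary, but
  \<open>inv_rad\<close> multiplies it by \<open>sgn 0\<close>.\<close>

definition len :: "'p \<Rightarrow> 'b \<Rightarrow> real" where
  "len p v = (SOME s. 0 \<le> s \<and> s < r \<and> f p (s *\<^sub>R sgn v) = (norm v)\<^sup>2)"

definition inv_rad :: "'p \<Rightarrow> 'b \<Rightarrow> 'b" where
  "inv_rad p v = len p v *\<^sub>R sgn v"

lemma sgn_in: "w \<in> S \<Longrightarrow> sgn w \<in> S"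
  using S by (simp add: sgn_div_norm subspace_scale)

lemma nonneg: "\<lbrakk>p \<in> A; w \<in> S; norm w < r\<rbrakk> \<Longrightarrow> 0 \<le> f p w"
  using coercive[of p w] c by (meson mult_nonneg_nonneg less_imp_le order_trans zero_le_power2)

text \<open>\<open>strict\<close> starts from nonzero points only; a ray starting at the origin is
  handled by coercivity.\<close>

lemma strict_ray:
  assumes "p \<in> A" "v \<in> S" "v \<noteq> 0" "0 \<le> s" "s < t" "t < r"
  shows "f p (s *\<^sub>R sgn v) < f p (t *\<^sub>R sgn v)"
proof (cases "s = 0")
  case True
  have "0 < c * (norm (t *\<^sub>R sgn v))\<^sup>2" using assms c by (simp add: norm_sgn)
  also have "\<dots> \<le> f p (t *\<^sub>R sgn v)"
    using assms S by (intro coercive subspace_scale sgn_in) (auto simp: norm_sgn)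
  finally show ?thesis using True zero assms by simp
next
  case False
  then have "f p (s *\<^sub>R sgn v) < f p ((t / s) *\<^sub>R s *\<^sub>R sgn v)"
    using assms S by (intro strict subspace_scale sgn_in) (auto simp: norm_sgn sgn_zero_iff)
  then show ?thesis using False by simp
qed

lemma len:
  assumes p: "p \<in> A" and v: "v \<in> S" "norm v < sqrt c * r"
  shows "0 \<le> len p v" "len p v < r" "f p (len p v *\<^sub>R sgn v) = (norm v)\<^sup>2"
proof -
  have "\<exists>s. 0 \<le> s \<and> s < r \<and> f p (s *\<^sub>R sgn v) = (norm v)\<^sup>2"
  proof (cases "v = 0")
    case True
    then show ?thesis using zero p r by (intro exI[of _ 0]) auto
  next
    case False
    \<comment> \<open>The radius at which the coercive lower bound reaches the prescribed value; the
      intermediate value theorem applies on \<open>{0..b}\<close>.\<close>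
    define b where "b = norm v / sqrt c"
    have b: "0 \<le> b" "b < r" using v c by (auto simp: b_def field_simps)
    have "s *\<^sub>R sgn v \<in> S \<inter> ball 0 r" if "s \<in> {0..b}" for s
      using that subspace_scale[OF S sgn_in[OF v(1)]] b False by (simp add: norm_sgn)
    then have "continuous_on {0..b} (\<lambda>s. (\<lambda>(p, w). f p w) (p, s *\<^sub>R sgn v))"
      using p by (intro continuous_on_compose2[OF cont, of _ "\<lambda>s. (p, s *\<^sub>R sgn v)"] continuous_intros) blast
    then have "continuous_on {0..b} (\<lambda>s. f p (s *\<^sub>R sgn v))" by simp
    moreover have "f p (0 *\<^sub>R sgn v) \<le> (norm v)\<^sup>2" using zero p by simp
    moreover have "(norm v)\<^sup>2 \<le> f p (b *\<^sub>R sgn v)"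
    proof -
      have "(norm v)\<^sup>2 = c * (norm (b *\<^sub>R sgn v))\<^sup>2"
        using c False b by (simp add: norm_sgn b_def power_divide)
      also have "\<dots> \<le> f p (b *\<^sub>R sgn v)"
        using p v b S False by (intro coercive subspace_scale sgn_in) (auto simp: norm_sgn)
      finally show ?thesis .
    qed
    ultimately obtain s where "0 \<le> s" "s \<le> b" "f p (s *\<^sub>R sgn v) = (norm v)\<^sup>2"
      using IVT'[of "\<lambda>s. f p (s *\<^sub>R sgn v)" 0 "(norm v)\<^sup>2" b] b by auto
    then show ?thesis using b by (intro exI[of _ s]) auto
  qed
  from someI_ex[OF this] show "0 \<le> len p v" "len p v < r" "f p (len p v *\<^sub>R sgn v) = (norm v)\<^sup>2"
    by (auto simp: len_def)
qed

lemma len_unique: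
  assumes p: "p \<in> A" and v: "v \<in> S" "norm v < sqrt c * r" "v \<noteq> 0"
    and s: "0 \<le> s" "s < r" "f p (s *\<^sub>R sgn v) = (norm v)\<^sup>2"
  shows "len p v = s"
  using strict_ray[OF p v(1,3), of s "len p v"] strict_ray[OF p v(1,3), of "len p v" s]
    len[OF p v(1,2)] s by (cases s "len p v" rule: linorder_cases) auto

lemma rad_in: "w \<in> S \<Longrightarrow> rad p w \<in> S"
  unfolding rad_def using S by (intro subspace_scale sgn_in)

lemma inv_rad_in: "v \<in> S \<Longrightarrow> inv_rad p v \<in> S"
  unfolding inv_rad_def using S by (intro subspace_scale sgn_in)

lemma inv_rad_0 [simp]: "inv_rad p 0 = 0"
  by (simp add: inv_rad_def)

lemma norm_rad:
  assumes "p \<in> A" "w \<in> S" "norm w < r"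
  shows "(norm (rad p w))\<^sup>2 = f p w"
  using assms nonneg[OF assms] zero by (cases "w = 0") (auto simp: rad_def norm_sgn)

lemma norm_inv_rad:
  assumes "p \<in> A" "v \<in> S" "norm v < sqrt c * r"
  shows "norm (inv_rad p v) < r" "norm (inv_rad p v) \<le> norm v / sqrt c"
    "f p (inv_rad p v) = (norm v)\<^sup>2"
proof -
  note l = len[OF assms]
  show r': "norm (inv_rad p v) < r" using l r by (simp add: inv_rad_def norm_sgn)
  show f: "f p (inv_rad p v) = (norm v)\<^sup>2" using l by (simp add: inv_rad_def)
  have "c * (norm (inv_rad p v))\<^sup>2 \<le> (norm v)\<^sup>2"
    using coercive[OF assms(1) inv_rad_in[OF assms(2)] r'] f by simp
  then have "(norm (inv_rad p v))\<^sup>2 \<le> (norm v / sqrt c)\<^sup>2"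
    using c by (simp add: power_divide field_simps)
  then show "norm (inv_rad p v) \<le> norm v / sqrt c"
    by (rule power2_le_imp_le) (use c in auto)
qed

lemma rad_inv_rad:
  assumes "p \<in> A" "v \<in> S" "norm v < sqrt c * r"
  shows "rad p (inv_rad p v) = v"
proof (cases "v = 0")
  case False
  note l = len[OF assms]
  have "len p v \<noteq> 0" using l zero assms False by auto
  then have "sgn (inv_rad p v) = sgn v" using l by (simp add: inv_rad_def sgn_scaleR sgn_sgn)
  then show ?thesis
    using norm_inv_rad(3)[OF assms] by (simp add: rad_def norm_scaleR_sgn)
qed (simp add: rad_def)

lemma inv_rad_rad:
  assumes "p \<in> A" "w \<in> S" "norm w < r" "norm (rad p w) < sqrt c * r"
  shows "inv_rad p (rad p w) = w"
proof (cases "w = 0")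
  case False
  then have "0 < c * (norm w)\<^sup>2" using c by simp
  also have "\<dots> \<le> f p w" using coercive assms by blast
  finally have "f p w > 0" .
  then have sg: "sgn (rad p w) = sgn w" and ne: "rad p w \<noteq> 0"
    using False by (auto simp: rad_def sgn_scaleR sgn_zero_iff sgn_sgn)
  have "len p (rad p w) = norm w"
    using assms False ne norm_rad[OF assms(1-3)]
    by (intro len_unique rad_in) (auto simp: sg norm_scaleR_sgn)
  then show ?thesis by (simp add: inv_rad_def sg norm_scaleR_sgn)
qed (simp add: rad_def)

lemma continuous_on_rad: "continuous_on (A \<times> (S \<inter> ball 0 r)) (\<lambda>(p, w). rad p w)"
  unfolding continuous_on_def
proof
  fix z assume z: "z \<in> A \<times> (S \<inter> ball 0 r)"
  let ?F = "at z within A \<times> (S \<inter> ball 0 r)"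
  have f: "((\<lambda>z. f (fst z) (snd z)) \<longlongrightarrow> f (fst z) (snd z)) ?F"
    using cont z unfolding continuous_on_def by (auto simp: case_prod_unfold)
  have *: "((\<lambda>z. rad (fst z) (snd z)) \<longlongrightarrow> rad (fst z) (snd z)) ?F"
  proof (cases "snd z = 0")
    case True
    \<comment> \<open>\<open>sgn\<close> jumps at 0, so here the limit is forced by the length
      \<open>sqrt (f p w)\<close> alone.\<close>
    have "((\<lambda>z. sqrt (f (fst z) (snd z))) \<longlongrightarrow> sqrt (f (fst z) (snd z))) ?F"
      by (intro tendsto_intros f)
    then have "((\<lambda>z. \<bar>sqrt (f (fst z) (snd z))\<bar>) \<longlongrightarrow> 0) ?F"
      using True zero z by (auto intro!: tendsto_rabs_zero)
    moreover have "\<forall>\<^sub>F z in ?F. norm (rad (fst z) (snd z)) \<le> \<bar>sqrt (f (fst z) (snd z))\<bar>"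
      by (intro always_eventually) (auto simp: rad_def norm_sgn)
    ultimately have "((\<lambda>z. rad (fst z) (snd z)) \<longlongrightarrow> 0) ?F"
      by (rule Lim_null_comparison[rotated])
    then show ?thesis using True by (simp add: rad_def)
  next
    case False
    then show ?thesis unfolding rad_def
      by (intro tendsto_intros f tendsto_sgn)
  qed
  then show "((\<lambda>(p, w). rad p w) \<longlongrightarrow> (case z of (p, w) \<Rightarrow> rad p w)) ?F"
    by (simp add: case_prod_unfold)
qed

text \<open>\<open>len\<close> is an implicit function given by a monotone equation, so its continuity is that of
  the two strict inequalities on either side of the solution.\<close>

lemma continuous_on_inv_rad:
  "continuous_on (A \<times> (S \<inter> ball 0 (sqrt c * r))) (\<lambda>(p, v). inv_rad p v)"
  unfolding continuous_on_def
proof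
  define D where "D = A \<times> (S \<inter> ball 0 (sqrt c * r))"
  fix z assume "z \<in> A \<times> (S \<inter> ball 0 (sqrt c * r))"
  then have z: "z \<in> D" by (simp add: D_def)
  let ?F = "at z within D"
  have ev_D: "\<forall>\<^sub>F z in ?F. z \<in> D" by (simp add: eventually_at_filter)
  have D: "fst y \<in> A" "snd y \<in> S" "norm (snd y) < sqrt c * r" if "y \<in> D" for y
    using that by (auto simp: D_def)
  have "((\<lambda>z. inv_rad (fst z) (snd z)) \<longlongrightarrow> inv_rad (fst z) (snd z)) ?F"
  proof (cases "snd z = 0")
    case True
    \<comment> \<open>\<open>len\<close> is arbitrary at 0, so continuity there rests on the linear
      bound for \<open>inv_rad\<close>.\<close>
    have "((\<lambda>z. norm (snd z) / sqrt c) \<longlongrightarrow> norm (snd z) / sqrt c) ?F"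
      using c by (intro tendsto_intros) auto
    then have "((\<lambda>z. norm (snd z) / sqrt c) \<longlongrightarrow> 0) ?F" using True by simp
    moreover have "\<forall>\<^sub>F z in ?F. norm (inv_rad (fst z) (snd z)) \<le> norm (snd z) / sqrt c"
      using ev_D by eventually_elim (intro norm_inv_rad D)
    ultimately have "((\<lambda>z. inv_rad (fst z) (snd z)) \<longlongrightarrow> 0) ?F"
      by (rule Lim_null_comparison[rotated])
    then show ?thesis using True by simp
  next
    case False
    have snd_lim: "((\<lambda>z. (norm (snd z))\<^sup>2) \<longlongrightarrow> (norm (snd z))\<^sup>2) ?F"
      by (intro tendsto_intros)
    have f_lim: "((\<lambda>z. f (fst z) (a *\<^sub>R sgn (snd z))) \<longlongrightarrow> f (fst z) (a *\<^sub>R sgn (snd z))) ?F"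
      if a: "0 \<le> a" "a < r" for a
    proof -
      have in_dom: "(fst y, a *\<^sub>R sgn (snd y)) \<in> A \<times> (S \<inter> ball 0 r)" if "y \<in> D" for y
        using D[OF that] a r S by (auto simp: norm_sgn intro!: subspace_scale sgn_in)
      have "((\<lambda>z. (fst z, a *\<^sub>R sgn (snd z))) \<longlongrightarrow> (fst z, a *\<^sub>R sgn (snd z))) ?F"
        using False by (intro tendsto_intros tendsto_sgn)
      from continuous_on_tendsto_compose[OF cont this in_dom[OF z]]
      show ?thesis using eventually_mono[OF ev_D in_dom] by simp
    qed
    have lower: "\<forall>\<^sub>F y in ?F. a < len (fst y) (snd y)" if a: "a < len (fst z) (snd z)" for a
    proof (cases "a < 0")
      case True
      show ?thesis using ev_D
        by eventually_elim (use True len(1) D in \<open>meson less_le_trans\<close>)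
    next
      case a0: False
      have ar: "a < r" using a len(2)[OF D[OF z]] by simp
      have "f (fst z) (a *\<^sub>R sgn (snd z)) < (norm (snd z))\<^sup>2"
        using strict_ray[of "fst z" "snd z" a "len (fst z) (snd z)"] D[OF z] False a a0 len[OF D[OF z]]
        by simp
      then have "\<forall>\<^sub>F y in ?F. (norm (snd y))\<^sup>2 - f (fst y) (a *\<^sub>R sgn (snd y)) > 0"
        using a0 ar by (intro order_tendstoD(1)[OF tendsto_diff[OF snd_lim f_lim]]) auto
      with ev_D show ?thesis
      proof eventually_elim
        case (elim y)
        note l = len[OF D[OF elim(1)]]
        \<comment> \<open>The strict inequality just obtained would fail at a zero vector, where
          both terms are 0.\<close>
        have ne: "snd y \<noteq> 0" using elim(2) zero D[OF elim(1)] by auto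
        show ?case
        proof (rule ccontr)
          assume "\<not> a < len (fst y) (snd y)"
          then have "f (fst y) (len (fst y) (snd y) *\<^sub>R sgn (snd y)) \<le> f (fst y) (a *\<^sub>R sgn (snd y))"
            using strict_ray[of "fst y" "snd y" "len (fst y) (snd y)" a] D[OF elim(1)] ne l ar
            by (cases "len (fst y) (snd y) = a") auto
          then show False using l elim by simp
        qed
      qed
    qed
    have upper: "\<forall>\<^sub>F y in ?F. len (fst y) (snd y) < a" if a: "len (fst z) (snd z) < a" for a
    proof -
      \<comment> \<open>Capped halfway between the solution and \<open>r\<close>, because
        \<open>f\<close> is controlled only below \<open>r\<close>.\<close>
      define a' where "a' = min a ((len (fst z) (snd z) + r) / 2)"
      have a': "len (fst z) (snd z) < a'" "a' < r" "0 \<le> a'" "a' \<le> a"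
        using a len[OF D[OF z]] by (auto simp: a'_def min_less_iff_disj)
      have "(norm (snd z))\<^sup>2 < f (fst z) (a' *\<^sub>R sgn (snd z))"
        using strict_ray[of "fst z" "snd z" "len (fst z) (snd z)" a'] D[OF z] False a' len[OF D[OF z]]
        by simp
      then have "\<forall>\<^sub>F y in ?F. f (fst y) (a' *\<^sub>R sgn (snd y)) - (norm (snd y))\<^sup>2 > 0"
        using a' by (intro order_tendstoD(1)[OF tendsto_diff[OF f_lim snd_lim]]) auto
      with ev_D show ?thesis
      proof eventually_elim
        case (elim y)
        note l = len[OF D[OF elim(1)]]
        have ne: "snd y \<noteq> 0" using elim(2) zero D[OF elim(1)] by auto
        have "len (fst y) (snd y) < a'"
        proof (rule ccontr)
          assume "\<not> len (fst y) (snd y) < a'"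
          then have "f (fst y) (a' *\<^sub>R sgn (snd y)) \<le> f (fst y) (len (fst y) (snd y) *\<^sub>R sgn (snd y))"
            using strict_ray[of "fst y" "snd y" a' "len (fst y) (snd y)"] D[OF elim(1)] ne l a'
            by (cases "len (fst y) (snd y) = a'") auto
          then show False using l elim by simp
        qed
        with a' show ?case by simp
      qed
    qed
    have "((\<lambda>z. len (fst z) (snd z)) \<longlongrightarrow> len (fst z) (snd z)) ?F"
      by (rule order_tendstoI) (use lower upper in auto)
    then show ?thesis unfolding inv_rad_def
      using False by (intro tendsto_intros tendsto_sgn)
  qed
  then show "((\<lambda>(p, v). inv_rad p v) \<longlongrightarrow> (case z of (p, v) \<Rightarrow> inv_rad p v))
      (at z within A \<times> (S \<inter> ball 0 (sqrt c * r)))"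
    by (simp add: case_prod_unfold D_def)
qed

end

section \<open>Normal form of a saddle\<close>

lemma GDERIV_line:
  assumes "GDERIV L (z + t *\<^sub>R d) :> D"
  shows "((\<lambda>s. L (z + s *\<^sub>R d)) has_real_derivative D \<bullet> d) (at t)"
proof -
  have "(L has_derivative (\<lambda>h. D \<bullet> h)) (at (z + t *\<^sub>R d))"
    using assms by (simp add: gderiv_def inner_commute)
  then have "((\<lambda>s. L (z + s *\<^sub>R d)) has_derivative (\<lambda>h. D \<bullet> (h *\<^sub>R d))) (at t)"
    by (rule has_derivative_compose[rotated]) (auto intro!: derivative_eq_intros)
  moreover have "(\<lambda>h. D \<bullet> (h *\<^sub>R d)) = (*) (D \<bullet> d)" by (simp add: fun_eq_iff mult.commute)
  ultimately show ?thesis by (simp only: has_field_derivative_def)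
qed

lemma open_Collect_less_on:
  assumes "open S" "continuous_on S (f :: 'a::topological_space \<Rightarrow> real)"
  shows "open {z \<in> S. f z < a}"
proof -
  have "{z \<in> S. f z < a} = S \<inter> f -` {..<a}" by auto
  then show ?thesis using continuous_open_preimage[OF assms(2,1), of "{..<a}"] by simp
qed

lemma proj_inner_span:
  assumes "orthonormal E" "finite E" "v \<in> span E"
  shows "proj E w \<bullet> v = w \<bullet> v"
  using orthogonal_comp_span[OF diff_proj[OF assms(1,2)] assms(3), of w]
  by (simp add: inner_diff_left)

text \<open>As two-point inequalities, \<open>mono_M\<close> and \<open>mono_N\<close> make sense
  for a gradient without derivative. \<open>lip_N\<close> adds the Lipschitz bound for a contraction
  on the fibres; its coupling constant \<open>b\<close> limits the N-component of \<open>g x\<close>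
  to \<open>b * norm x\<close>.\<close>

locale saddle =
  fixes E :: "'a::{real_inner, complete_space} set" and L :: "'a \<Rightarrow> real" and g :: "'a \<Rightarrow> 'a"
    and b C r :: real and M N :: "'a set"
  defines "M \<equiv> orthogonal_comp E" and "N \<equiv> span E"
  assumes E: "orthonormal E" "finite E" and b: "b > 0" and r: "r > 0"
    and grad: "\<And>x y. \<lbrakk>x \<in> M; y \<in> N; norm x < r; norm y < r\<rbrakk> \<Longrightarrow> GDERIV L (x + y) :> g (x + y)"
    and g0: "g 0 = 0"
    and mono_M: "\<And>x x' y y'. \<lbrakk>x \<in> M; x' \<in> M; y \<in> N; y' \<in> N; norm x < r; norm x' < r; norm y < r; norm y' < r\<rbrakk>
      \<Longrightarrow> 2 * b * (norm (x' - x))\<^sup>2 - b * norm (x' - x) * norm (y' - y)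
          \<le> (g (x' + y') - g (x + y)) \<bullet> (x' - x)"
    and mono_N: "\<And>x x' y y'. \<lbrakk>x \<in> M; x' \<in> M; y \<in> N; y' \<in> N; norm x < r; norm x' < r; norm y < r; norm y' < r\<rbrakk>
      \<Longrightarrow> (g (x' + y') - g (x + y)) \<bullet> (y' - y)
          \<le> - 2 * b * (norm (y' - y))\<^sup>2 + b * norm (x' - x) * norm (y' - y)"
    and lip_N: "\<And>x x' y y' v. \<lbrakk>x \<in> M; x' \<in> M; y \<in> N; y' \<in> N; norm x < r; norm x' < r; norm y < r; norm y' < r; v \<in> N\<rbrakk>
      \<Longrightarrow> (g (x' + y') - g (x + y)) \<bullet> v \<le> (b * norm (x' - x) + C * norm (y' - y)) * norm v"
begin

section \<open>Critical points of the functional on the fibres\<close>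

lemma subM: "subspace M" and subN: "subspace N" and cN: "closed N"
  and M0 [simp]: "0 \<in> M" and N0 [simp]: "0 \<in> N"
proof -
  show "subspace M" unfolding M_def by (rule subspace_orthogonal_comp)
  show "subspace N" unfolding N_def by (rule subspace_span)
  show "closed N" unfolding N_def by (rule closed_span[OF E])
qed (simp_all add: M_def N_def subspace_0 subspace_orthogonal_comp span_zero)

text \<open>Compared with the origin, each component vanishes or is at most half as long as the
  other one.\<close>

lemma critical_point_0:
  assumes "x \<in> M" "y \<in> N" "norm x < r" "norm y < r" "g (x + y) = 0"
  shows "x + y = 0"
proof -
  have "b * (norm x * (2 * norm x - norm y)) \<le> 0"
    using mono_M[of 0 x 0 y] assms r by (simp add: g0 algebra_simps power2_eq_square)
  then have 1: "norm x * (2 * norm x - norm y) \<le> 0" using b by (simp add: mult_le_0_iff)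
  have "b * (norm y * (2 * norm y - norm x)) \<le> 0"
    using mono_N[of 0 x 0 y] assms r by (simp add: g0 algebra_simps power2_eq_square)
  then have 2: "norm y * (2 * norm y - norm x) \<le> 0" using b by (simp add: mult_le_0_iff)
  have "norm x = 0 \<or> 2 * norm x \<le> norm y" "norm y = 0 \<or> 2 * norm y \<le> norm x"
    using 1 2 by (auto simp: mult_le_0_iff)
  then have "norm x = 0" "norm y = 0" using norm_ge_zero[of x] norm_ge_zero[of y] by linarith+
  then show ?thesis by simp
qed

text \<open>Minus the N-component of \<open>g\<close> is strongly monotone on the fibre with
  constant \<open>2 * b\<close>, and at \<open>y = 0\<close> its size is at most
  \<open>b * norm x\<close>. That ratio is what places the zero within radius
  \<open>norm x\<close>.\<close>

lemma fibre_critical_ex: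
  assumes x: "x \<in> M" "norm x < r"
  shows "\<exists>y\<in>N. norm y \<le> norm x \<and> (\<forall>v\<in>N. g (x + y) \<bullet> v = 0)"
proof -
  note pin = proj_inner_span[OF E, folded N_def]
  have pN: "proj E w \<in> N" for w unfolding N_def by (rule proj_in_span)
  interpret proj: bounded_linear "proj E" by (rule bounded_linear_proj)
  have bound: "norm (proj E w) \<le> k" if "w \<bullet> proj E w \<le> k * norm (proj E w)" "k \<ge> 0" for w k
  proof -
    have "(norm (proj E w))\<^sup>2 \<le> k * norm (proj E w)"
      using that pin[OF pN, of w w] by (simp add: power2_norm_eq_inner)
    then show ?thesis using that(2) by (cases "proj E w = 0") (auto simp: power2_eq_square)
  qed
  have abs_C: "C * norm w \<le> \<bar>C\<bar> * norm w" for w :: 'a by (intro mult_right_mono) auto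
  obtain y where y: "y \<in> N" "norm y \<le> norm x" "- proj E (g (x + y)) = 0"
  proof (rule strongly_monotone_zero[OF subN cN, of "norm x" "2 * b" "\<lambda>y. - proj E (g (x + y))" "\<bar>C\<bar>"])
    fix y y' assume y: "y \<in> N" "y' \<in> N" "norm y \<le> norm x" "norm y' \<le> norm x"
    have eq: "- proj E (g (x + y)) - - proj E (g (x + y')) = - proj E (g (x + y) - g (x + y'))"
      by (simp add: proj.diff)
    have "y - y' \<in> N" using y subN by (simp add: subspace_diff)
    then show "2 * b * (norm (y - y'))\<^sup>2 \<le> (- proj E (g (x + y)) - - proj E (g (x + y'))) \<bullet> (y - y')"
      unfolding eq using mono_N[of x x y' y] x y by (simp add: pin)
    have "(g (x + y) - g (x + y')) \<bullet> proj E (g (x + y) - g (x + y'))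
        \<le> C * norm (y - y') * norm (proj E (g (x + y) - g (x + y')))"
      using lip_N[of x x y' y "proj E (g (x + y) - g (x + y'))"] x y pN by simp
    also have "\<dots> \<le> \<bar>C\<bar> * norm (y - y') * norm (proj E (g (x + y) - g (x + y')))"
      by (intro mult_right_mono abs_C) auto
    finally show "norm (- proj E (g (x + y)) - - proj E (g (x + y'))) \<le> \<bar>C\<bar> * norm (y - y')"
      unfolding eq norm_minus_cancel by (rule bound) simp
  next
    have "g x \<bullet> proj E (g x) \<le> b * norm x * norm (proj E (g x))"
      using lip_N[of 0 x 0 0 "proj E (g x)"] x r pN by (simp add: g0)
    then have "norm (proj E (g x)) \<le> b * norm x" by (rule bound) (use b in simp)
    then show "norm (- proj E (g (x + 0))) \<le> 2 * b * norm x / 2" by simp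
  qed (use b pN subN in \<open>auto simp: subspace_neg\<close>)
  have "g (x + y) \<bullet> v = 0" if "v \<in> N" for v
    using pin[OF that, of "g (x + y)"] y(3) by simp
  with y show ?thesis by blast
qed

definition peak :: "'a \<Rightarrow> 'a" where
  "peak x = (SOME y. y \<in> N \<and> norm y \<le> norm x \<and> (\<forall>v\<in>N. g (x + y) \<bullet> v = 0))"

lemma peak:
  assumes "x \<in> M" "norm x < r"
  shows "peak x \<in> N" "norm (peak x) \<le> norm x" "v \<in> N \<Longrightarrow> g (x + peak x) \<bullet> v = 0"
  using someI_ex[of "\<lambda>y. y \<in> N \<and> norm y \<le> norm x \<and> (\<forall>v\<in>N. g (x + y) \<bullet> v = 0)"]
    fibre_critical_ex[OF assms] by (auto simp: peak_def)

lemma peak_0 [simp]: "peak 0 = 0"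
  using peak(2)[of 0] r by simp

text \<open>At both peaks \<open>g\<close> is orthogonal to \<open>N\<close>, so the left side of
  \<open>mono_N\<close> vanishes; what survives is the ratio of the coupling constant
  \<open>b\<close> to the diagonal constant \<open>2 * b\<close>.\<close>

lemma peak_lipschitz:
  assumes "x \<in> M" "norm x < r" "x' \<in> M" "norm x' < r"
  shows "norm (peak x' - peak x) \<le> norm (x' - x) / 2"
proof -
  note p = peak[OF assms(1,2)] and p' = peak[OF assms(3,4)]
  define n where "n = norm (peak x' - peak x)"
  have "peak x' - peak x \<in> N" using p p' subN by (simp add: subspace_diff)
  then have "(g (x' + peak x') - g (x + peak x)) \<bullet> (peak x' - peak x) = 0"
    using p p' by (simp add: inner_diff_left)
  then have "0 \<le> - 2 * b * n\<^sup>2 + b * norm (x' - x) * n"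
    using mono_N[of x x' "peak x" "peak x'"] assms p p' by (simp add: n_def)
  then have "b * (n * (2 * n - norm (x' - x))) \<le> 0"
    by (simp add: algebra_simps power2_eq_square)
  then have "n * (2 * n - norm (x' - x)) \<le> 0" using b by (simp add: mult_le_0_iff)
  moreover have "n \<ge> 0" by (simp add: n_def)
  ultimately have "n \<le> norm (x' - x) / 2" by (auto simp: mult_le_0_iff)
  then show ?thesis by (simp add: n_def)
qed

lemma norm_peak: "x \<in> M \<Longrightarrow> norm x < r \<Longrightarrow> norm (peak x) \<le> norm x / 2"
  using peak_lipschitz[of 0 x] r by simp

lemma continuous_on_peak: "continuous_on (M \<inter> ball 0 r) peak"
proof (rule lipschitz_on_continuous_on)
  show "(1/2)-lipschitz_on (M \<inter> ball 0 r) peak"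
    using peak_lipschitz by (intro lipschitz_onI) (auto simp: dist_norm)
qed

section \<open>Quadratic growth and decay along rays\<close>

lemma continuous_on_L: "continuous_on {x + y | x y. x \<in> M \<and> y \<in> N \<and> norm x < r \<and> norm y < r} L"
  using grad unfolding gderiv_def
  by (intro continuous_at_imp_continuous_on) (blast intro: has_derivative_continuous)

text \<open>Together with \<open>peak_height\<close> it splits
  \<open>L (x + peak x + y) - L 0\<close> as \<open>peak_height x - peak_drop x y\<close>, already
  in the shape of the normal form; each term only has to become a square.\<close>

definition peak_drop :: "'a \<Rightarrow> 'a \<Rightarrow> real" where
  "peak_drop x y = L (x + peak x) - L (x + peak x + y)"

definition peak_height :: "'a \<Rightarrow> real" where
  "peak_height x = L (x + peak x) - L 0"

text \<open>The comparison point is the peak, where \<open>g\<close> annihilates \<open>N\<close>.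
  The monotonicity estimate has to be divided by \<open>s\<close>, so \<open>s = 0\<close> falls to
  the peak equation itself.\<close>

lemma fibre_derivative:
  assumes x: "x \<in> M" "norm x < r / 2" and y: "y \<in> N" and s: "norm (s *\<^sub>R y) < r / 2" "s \<ge> 0"
  shows "((\<lambda>s. L (x + peak x + s *\<^sub>R y)) has_real_derivative g (x + peak x + s *\<^sub>R y) \<bullet> y) (at s)"
    and "g (x + peak x + s *\<^sub>R y) \<bullet> y \<le> - 2 * b * s * (norm y)\<^sup>2"
proof -
  have xr: "norm x < r" using x r by simp
  note p = peak[OF x(1) xr]
  have sy: "s *\<^sub>R y \<in> N" using y subN by (simp add: subspace_scale)
  have "norm (peak x + s *\<^sub>R y) \<le> norm x / 2 + norm (s *\<^sub>R y)"
    using norm_peak[OF x(1) xr] norm_triangle_ineq[of "peak x" "s *\<^sub>R y"] by linarith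
  also have "\<dots> < r" using x s r by linarith
  finally have ny: "norm (peak x + s *\<^sub>R y) < r" .
  have in_N: "peak x + s *\<^sub>R y \<in> N" using p sy subN by (simp add: subspace_add)
  have "GDERIV L (x + peak x + s *\<^sub>R y) :> g (x + peak x + s *\<^sub>R y)"
    using grad[OF x(1) in_N xr ny] by (simp add: add.assoc)
  then show "((\<lambda>s. L (x + peak x + s *\<^sub>R y)) has_real_derivative g (x + peak x + s *\<^sub>R y) \<bullet> y) (at s)"
    by (rule GDERIV_line)
  show "g (x + peak x + s *\<^sub>R y) \<bullet> y \<le> - 2 * b * s * (norm y)\<^sup>2"
  proof (cases "s = 0")
    case True
    then show ?thesis using p(3)[OF y] by simp
  next
    case False
    have "s * (g (x + peak x + s *\<^sub>R y) \<bullet> y) \<le> s * (- 2 * b * s * (norm y)\<^sup>2)"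
      using mono_N[of x x "peak x" "peak x + s *\<^sub>R y"] x xr p in_N ny y s
      by (simp add: add.assoc inner_diff_left power_mult_distrib power2_eq_square mult_ac)
    then show ?thesis by (rule mult_left_le_imp_le) (use False s in simp)
  qed
qed

lemma peak_drop_coercive:
  assumes x: "x \<in> M" "norm x < r / 2" and y: "y \<in> N" "norm y < r / 2"
  shows "b * (norm y)\<^sup>2 \<le> peak_drop x y"
proof -
  \<comment> \<open>The derivative of the added term is exactly what the bound on the fibre
    derivative compensates.\<close>
  let ?h = "\<lambda>s. L (x + peak x + s *\<^sub>R y) + b * s\<^sup>2 * (norm y)\<^sup>2"
  have "?h 1 \<le> ?h 0"
  proof (rule DERIV_nonpos_imp_nonincreasing[of 0 1 ?h])
    fix s :: real assume s: "0 \<le> s" "s \<le> 1"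
    then have "norm (s *\<^sub>R y) \<le> norm y" by (simp add: mult_left_le_one_le)
    then have ns: "norm (s *\<^sub>R y) < r / 2" using y by simp
    note d = fibre_derivative[OF x y(1) ns s(1)]
    have "(?h has_real_derivative g (x + peak x + s *\<^sub>R y) \<bullet> y + 2 * b * s * (norm y)\<^sup>2) (at s)"
      by (rule derivative_eq_intros d(1) refl | simp)+
    then show "\<exists>z. (?h has_real_derivative z) (at s) \<and> z \<le> 0"
      using d(2) by (intro exI[of _ "g (x + peak x + s *\<^sub>R y) \<bullet> y + 2 * b * s * (norm y)\<^sup>2"]) simp
  qed simp
  then show ?thesis by (simp add: peak_drop_def)
qed

lemma peak_drop_strict:
  assumes x: "x \<in> M" "norm x < r / 2" and y: "y \<in> N" "y \<noteq> 0" and t: "1 < t" "norm (t *\<^sub>R y) < r / 2"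
  shows "peak_drop x y < peak_drop x (t *\<^sub>R y)"
proof -
  have "L (x + peak x + t *\<^sub>R y) < L (x + peak x + 1 *\<^sub>R y)"
  proof (rule DERIV_neg_imp_decreasing[OF t(1)])
    fix s :: real assume s: "1 \<le> s" "s \<le> t"
    then have "norm (s *\<^sub>R y) \<le> norm (t *\<^sub>R y)" by (simp add: mult_right_mono)
    then have ns: "norm (s *\<^sub>R y) < r / 2" using t by simp
    note d = fibre_derivative[OF x y(1) ns]
    have "- 2 * b * s * (norm y)\<^sup>2 < 0" using b s y by simp
    then show "\<exists>z. ((\<lambda>s. L (x + peak x + s *\<^sub>R y)) has_real_derivative z) (at s) \<and> z < 0"
      using d s by (intro exI[of _ "g (x + peak x + s *\<^sub>R y) \<bullet> y"]) auto
  qed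
  then show ?thesis by (simp add: peak_drop_def)
qed

text \<open>The N-component stays fixed while the M-component is scaled; the comparison point is the
  origin, where \<open>g\<close> vanishes.\<close>

lemma base_derivative:
  assumes x: "x \<in> M" "norm (s *\<^sub>R x) < r" and y: "y \<in> N" "norm y \<le> norm (s *\<^sub>R x)" and s: "s \<ge> 0"
  shows "((\<lambda>s. L (y + s *\<^sub>R x)) has_real_derivative g (y + s *\<^sub>R x) \<bullet> x) (at s)"
    and "s > 0 \<Longrightarrow> 2 * b * s * (norm x)\<^sup>2 - b * norm x * norm y \<le> g (y + s *\<^sub>R x) \<bullet> x"
proof -
  have yr: "norm y < r" using x y by simp
  have sx: "s *\<^sub>R x \<in> M" using x subM by (simp add: subspace_scale)
  show "((\<lambda>s. L (y + s *\<^sub>R x)) has_real_derivative g (y + s *\<^sub>R x) \<bullet> x) (at s)"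
    using grad[OF sx y(1) x(2) yr] by (intro GDERIV_line) (simp add: add.commute)
  assume "s > 0"
  have "s * (2 * b * s * (norm x)\<^sup>2 - b * norm x * norm y) \<le> s * (g (y + s *\<^sub>R x) \<bullet> x)"
    using mono_M[of 0 "s *\<^sub>R x" 0 y] x y yr sx r s
    by (simp add: g0 add.commute power_mult_distrib power2_eq_square right_diff_distrib mult_ac)
  then show "2 * b * s * (norm x)\<^sup>2 - b * norm x * norm y \<le> g (y + s *\<^sub>R x) \<bullet> x"
    using \<open>s > 0\<close> by simp
qed

text \<open>Growth is obtained on the ray inside \<open>M\<close>, at fibre coordinate 0; climbing
  from \<open>x\<close> to the peak over \<open>x\<close> cannot lower \<open>L\<close>.\<close>

lemma peak_height_coercive:
  assumes x: "x \<in> M" "norm x < r / 2"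
  shows "b * (norm x)\<^sup>2 \<le> peak_height x"
proof -
  let ?h = "\<lambda>s. L (0 + s *\<^sub>R x) - b * s\<^sup>2 * (norm x)\<^sup>2"
  have "?h 0 \<le> ?h 1"
  proof (rule DERIV_nonneg_imp_nondecreasing[of 0 1 ?h])
    fix s :: real assume s: "0 \<le> s" "s \<le> 1"
    then have "norm (s *\<^sub>R x) \<le> norm x" by (simp add: mult_left_le_one_le)
    then have ns: "norm (s *\<^sub>R x) < r" using x r by simp
    note d = base_derivative[OF x(1) ns N0 _ s(1)]
    have "2 * b * s * (norm x)\<^sup>2 \<le> g (0 + s *\<^sub>R x) \<bullet> x"
      using d(2) s by (cases "s = 0") (auto simp: g0)
    moreover have "(?h has_real_derivative g (0 + s *\<^sub>R x) \<bullet> x - 2 * b * s * (norm x)\<^sup>2) (at s)"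
      by (rule derivative_eq_intros d(1) refl | simp)+
    ultimately show "\<exists>z. (?h has_real_derivative z) (at s) \<and> 0 \<le> z"
      by (intro exI[of _ "g (0 + s *\<^sub>R x) \<bullet> x - 2 * b * s * (norm x)\<^sup>2"]) simp
  qed simp
  then have "b * (norm x)\<^sup>2 \<le> L x - L 0" by simp
  moreover have "0 \<le> peak_drop x (- peak x)"
  proof -
    have "norm x < r" using x r by simp
    then have "- peak x \<in> N" "norm (- peak x) < r / 2"
      using peak[OF x(1)] x subN by (auto simp: subspace_neg)
    from peak_drop_coercive[OF x this] show ?thesis
      using b by (meson mult_nonneg_nonneg less_imp_le order_trans zero_le_power2)
  qed
  ultimately show ?thesis by (simp add: peak_drop_def peak_height_def)
qed

text \<open>The path is split to avoid differentiating \<open>peak\<close>: first \<open>x\<close>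
  is scaled with \<open>peak x\<close> held fixed, which raises \<open>L\<close> strictly, then the
  point moves to the peak over \<open>t *\<^sub>R x\<close>, which does not lower it.\<close>

lemma peak_height_strict:
  assumes x: "x \<in> M" "x \<noteq> 0" and t: "1 < t" "norm (t *\<^sub>R x) < r / 2"
  shows "peak_height x < peak_height (t *\<^sub>R x)"
proof -
  have tx: "t *\<^sub>R x \<in> M" using x subM by (simp add: subspace_scale)
  have le: "norm x \<le> norm (s *\<^sub>R x)" if "s \<ge> 1" for s
    using that by (simp add: mult_le_cancel_right1)
  have xr: "norm x < r" "norm (t *\<^sub>R x) < r" using t le[of t] r by auto
  note p = peak[OF x(1) xr(1)] and p' = peak[OF tx xr(2)]
  have "L (peak x + 1 *\<^sub>R x) < L (peak x + t *\<^sub>R x)"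
  proof (rule DERIV_pos_imp_increasing[OF t(1)])
    fix s :: real assume s: "1 \<le> s" "s \<le> t"
    have "norm (s *\<^sub>R x) \<le> norm (t *\<^sub>R x)" using s by (simp add: mult_right_mono)
    then have ns: "norm (s *\<^sub>R x) < r" using t r by simp
    have "norm (peak x) \<le> norm (s *\<^sub>R x)" using p(2) le[OF s(1)] by simp
    note d = base_derivative[OF x(1) ns p(1) this]
    \<comment> \<open>The coupling thus uses up at most half of the diagonal term.\<close>
    have "b * norm x * norm (peak x) \<le> b * norm x * (s * norm x)"
      using \<open>norm (peak x) \<le> norm (s *\<^sub>R x)\<close> b s by (intro mult_left_mono) auto
    moreover have "0 < b * s * (norm x)\<^sup>2" using b s x by simp
    ultimately have "0 < 2 * b * s * (norm x)\<^sup>2 - b * norm x * norm (peak x)"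
      by (simp add: power2_eq_square algebra_simps)
    then show "\<exists>z. ((\<lambda>s. L (peak x + s *\<^sub>R x)) has_real_derivative z) (at s) \<and> 0 < z"
      using d s by (intro exI[of _ "g (peak x + s *\<^sub>R x) \<bullet> x"]) auto
  qed
  moreover have "0 \<le> peak_drop (t *\<^sub>R x) (peak x - peak (t *\<^sub>R x))"
  proof -
    have "norm (peak x - peak (t *\<^sub>R x)) \<le> norm (t *\<^sub>R x - x) / 2"
      using peak_lipschitz[OF x(1) xr(1) tx xr(2)] by (simp add: norm_minus_commute)
    also have "t *\<^sub>R x - x = (t - 1) *\<^sub>R x" by (simp add: algebra_simps)
    \<comment> \<open>Half of t - 1 is below t, so the second leg stays where
      \<open>peak_drop_coercive\<close> applies.\<close>
    also have "norm \<dots> / 2 \<le> norm (t *\<^sub>R x)"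
      using t mult_right_mono[of "(t - 1) / 2" t "norm x"] by simp
    finally have "norm (peak x - peak (t *\<^sub>R x)) < r / 2" using t by simp
    moreover have "peak x - peak (t *\<^sub>R x) \<in> N" using p p' subN by (simp add: subspace_diff)
    ultimately show ?thesis
      using peak_drop_coercive[OF tx t(2)] b by (meson mult_nonneg_nonneg less_imp_le order_trans zero_le_power2)
  qed
  ultimately show ?thesis by (simp add: peak_height_def peak_drop_def add.commute)
qed

section \<open>The chart, its inverse and its image\<close>

definition proj_M :: "'a \<Rightarrow> 'a" where "proj_M z = z - proj E z"

lemma proj_M_in: "proj_M z \<in> M" and proj_in: "proj E z \<in> N" and proj_M_proj: "proj_M z + proj E z = z"
  by (simp_all add: proj_M_def M_def N_def diff_proj[OF E] proj_in_span)

lemma proj_M_unique: "x \<in> M \<Longrightarrow> y \<in> N \<Longrightarrow> proj_M (x + y) = x"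
  and proj_add: "x \<in> M \<Longrightarrow> y \<in> N \<Longrightarrow> proj E (x + y) = y"
  using proj_unique[OF E, of x y] by (simp_all add: proj_M_def M_def N_def)

lemma continuous_on_proj: "continuous_on S (proj E)" and continuous_on_proj_M: "continuous_on S proj_M"
  unfolding proj_M_def
  by (intro continuous_intros linear_continuous_on bounded_linear_proj)+

lemma continuous_on_base: "continuous_on (M \<inter> ball 0 (r / 2)) (\<lambda>x. L (x + peak x))"
  using r peak
  by (intro continuous_on_compose2[OF continuous_on_L] continuous_intros
        continuous_on_subset[OF continuous_on_peak]) fastforce+

text \<open>The rescaling of \<open>M\<close> depends on no further point, so the parameter space is
  a singleton.\<close>

lemma radial_peak_height: "radial {0::real} M (\<lambda>_. peak_height) b (r / 2)"
proof
  have "continuous_on (M \<inter> ball 0 (r / 2)) peak_height"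
    unfolding peak_height_def by (intro continuous_intros continuous_on_base)
  then show "continuous_on ({0::real} \<times> (M \<inter> ball 0 (r / 2))) (\<lambda>(p, w). peak_height w)"
    unfolding case_prod_unfold by (rule continuous_on_compose2) (auto intro!: continuous_intros)
qed (use subM b r peak_height_coercive peak_height_strict in \<open>auto simp: peak_height_def\<close>)

lemma fibre_in_box:
  assumes "x \<in> M" "norm x < r / 2" "y \<in> N" "norm y < r / 2"
  shows "peak x + y \<in> N" "norm (peak x + y) < r" "norm x < r"
proof -
  show xr: "norm x < r" using assms r by simp
  show "peak x + y \<in> N" using peak[OF assms(1) xr] assms subN by (simp add: subspace_add)
  show "norm (peak x + y) < r"
    using norm_peak[OF assms(1) xr] norm_triangle_ineq[of "peak x" y] assms r by linarith
qed

lemma radial_peak_drop: "radial (M \<inter> ball 0 (r / 2)) N peak_drop b (r / 2)"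
proof
  let ?D = "(M \<inter> ball 0 (r / 2)) \<times> (N \<inter> ball 0 (r / 2))"
  have peak_D: "continuous_on ?D (\<lambda>z. peak (fst z))"
    by (rule continuous_on_compose2[OF continuous_on_peak]) (use r in \<open>auto intro!: continuous_intros\<close>)
  have "continuous_on ?D (\<lambda>z. L (fst z + peak (fst z)))"
    by (rule continuous_on_compose2[OF continuous_on_base]) (auto intro!: continuous_intros)
  moreover have "continuous_on ?D (\<lambda>z. L (fst z + (peak (fst z) + snd z)))"
  proof (rule continuous_on_compose2[OF continuous_on_L])
    show "continuous_on ?D (\<lambda>z. fst z + (peak (fst z) + snd z))"
      by (intro continuous_intros peak_D)
    show "(\<lambda>z. fst z + (peak (fst z) + snd z)) ` ?D
        \<subseteq> {x + y |x y. x \<in> M \<and> y \<in> N \<and> norm x < r \<and> norm y < r}"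
      using fibre_in_box by fastforce
  qed
  ultimately show "continuous_on ?D (\<lambda>(x, y). peak_drop x y)"
    unfolding case_prod_unfold peak_drop_def by (intro continuous_intros) (simp_all add: add.assoc)
qed (use subN b r peak_drop_coercive peak_drop_strict in \<open>auto simp: peak_drop_def\<close>)

sublocale base: radial "{0::real}" M "\<lambda>_. peak_height" b "r / 2" by (rule radial_peak_height)
sublocale fibre: radial "M \<inter> ball 0 (r / 2)" N peak_drop b "r / 2" by (rule radial_peak_drop)

text \<open>The bound \<open>sqrt c * r\<close> of the radial construction for its present data
  \<open>b\<close> and \<open>r / 2\<close>; below it the radial equations are solvable.\<close>

definition radius :: real where "radius = sqrt b * (r / 2)"

text \<open>Triangular: the base point is decoded from the M-component first, and the fibre
  coordinate is then decoded over that point, measured from its peak.\<close>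

definition chart :: "'a \<Rightarrow> 'a" where
  "chart z = base.inv_rad 0 (proj_M z) + (peak (base.inv_rad 0 (proj_M z))
     + fibre.inv_rad (base.inv_rad 0 (proj_M z)) (proj E z))"

definition coord :: "'a \<Rightarrow> 'a" where
  "coord z = base.rad 0 (proj_M z) + fibre.rad (proj_M z) (proj E z - peak (proj_M z))"

text \<open>The first two clauses place the arguments of the radial maps in their domains; the last
  two place the values in the product of balls, where \<open>inv_rad\<close> undoes
  \<open>rad\<close>.\<close>

definition nbhd :: "'a set" where
  "nbhd = {z. norm (proj_M z) < r / 2 \<and> norm (proj E z - peak (proj_M z)) < r / 2 \<and>
     norm (base.rad 0 (proj_M z)) < radius \<and> norm (fibre.rad (proj_M z) (proj E z - peak (proj_M z))) < radius}"

lemma nbhdD: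
  assumes "z \<in> nbhd"
  shows "norm (proj_M z) < r / 2" "norm (proj_M z) < r" "norm (proj E z - peak (proj_M z)) < r / 2"
    "proj E z - peak (proj_M z) \<in> N" "norm (proj E z) < r"
    "norm (base.rad 0 (proj_M z)) < radius" "norm (fibre.rad (proj_M z) (proj E z - peak (proj_M z))) < radius"
proof -
  show a: "norm (proj_M z) < r / 2" "norm (proj E z - peak (proj_M z)) < r / 2"
    "norm (base.rad 0 (proj_M z)) < radius" "norm (fibre.rad (proj_M z) (proj E z - peak (proj_M z))) < radius"
    using assms by (auto simp: nbhd_def)
  show b: "norm (proj_M z) < r" using a r by simp
  show N: "proj E z - peak (proj_M z) \<in> N"
    using peak(1)[OF proj_M_in b] proj_in subN by (simp add: subspace_diff)
  show "norm (proj E z) < r" using fibre_in_box(2)[OF proj_M_in a(1) N a(2)] by simp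
qed

lemma chart_props:
  assumes u: "u \<in> M" "norm u < radius" and v: "v \<in> N" "norm v < radius"
  shows "chart (u + v) \<in> nbhd" "coord (chart (u + v)) = u + v"
    "L (chart (u + v)) = (norm u)\<^sup>2 - (norm v)\<^sup>2 + L 0"
proof -
  define x where "x = base.inv_rad 0 u"
  define y where "y = fibre.inv_rad x v"
  have x: "x \<in> M" "norm x < r / 2" "peak_height x = (norm u)\<^sup>2" "base.rad 0 x = u"
    unfolding x_def using u base.norm_inv_rad(1,3)[of 0 u] base.inv_rad_in[of u] base.rad_inv_rad[of 0 u]
    by (auto simp: radius_def)
  then have xm: "x \<in> M \<inter> ball 0 (r / 2)" by simp
  have y: "y \<in> N" "norm y < r / 2" "peak_drop x y = (norm v)\<^sup>2" "fibre.rad x y = v"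
    unfolding y_def using v fibre.norm_inv_rad(1,3)[OF xm, of v] fibre.inv_rad_in[of v] fibre.rad_inv_rad[OF xm, of v]
    by (auto simp: radius_def)
  have N: "peak x + y \<in> N" using fibre_in_box[OF x(1,2) y(1,2)] by simp
  have c: "chart (u + v) = x + (peak x + y)"
    unfolding chart_def using u v by (simp add: proj_M_unique proj_add x_def y_def)
  have p: "proj_M (chart (u + v)) = x" "proj E (chart (u + v)) - peak x = y"
    unfolding c using x N by (simp_all add: proj_M_unique proj_add)
  show "chart (u + v) \<in> nbhd" using x y u v p by (simp add: nbhd_def)
  show "coord (chart (u + v)) = u + v" using x y p by (simp add: coord_def)
  show "L (chart (u + v)) = (norm u)\<^sup>2 - (norm v)\<^sup>2 + L 0"
    unfolding c using x(3) y(3) by (simp add: peak_height_def peak_drop_def add.assoc)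
qed

lemma chart_coord:
  assumes "z \<in> nbhd"
  shows "chart (coord z) = z"
proof -
  note n = nbhdD[OF assms]
  have m: "base.rad 0 (proj_M z) \<in> M" "fibre.rad (proj_M z) (proj E z - peak (proj_M z)) \<in> N"
    using base.rad_in[OF proj_M_in] fibre.rad_in[OF n(4)] by auto
  have "base.inv_rad 0 (base.rad 0 (proj_M z)) = proj_M z"
    using n proj_M_in by (intro base.inv_rad_rad) (auto simp: radius_def)
  moreover have "fibre.inv_rad (proj_M z) (fibre.rad (proj_M z) (proj E z - peak (proj_M z))) = proj E z - peak (proj_M z)"
    using n proj_M_in by (intro fibre.inv_rad_rad) (auto simp: radius_def)
  ultimately show ?thesis
    unfolding chart_def coord_def proj_M_unique[OF m] proj_add[OF m] by (simp add: proj_M_proj)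
qed

lemma continuous_on_chart: "continuous_on {u + v | u v. u \<in> M \<and> v \<in> N \<and> norm u < radius \<and> norm v < radius} chart"
proof -
  define D where "D = {u + v | u v. u \<in> M \<and> v \<in> N \<and> norm u < radius \<and> norm v < radius}"
  have D: "norm (proj_M z) < radius" "norm (proj E z) < radius" if "z \<in> D" for z
    using that by (auto simp: D_def proj_M_unique proj_add)
  have x: "continuous_on D (\<lambda>z. base.inv_rad 0 (proj_M z))"
    using D proj_M_in
    by (intro continuous_on_compose2[OF base.continuous_on_inv_rad, of D "\<lambda>z. (0, proj_M z)", simplified]
          continuous_intros continuous_on_proj_M) (auto simp: radius_def)
  have xm: "base.inv_rad 0 (proj_M z) \<in> M \<inter> ball 0 (r / 2)" if "z \<in> D" for z
    using D[OF that] proj_M_in base.inv_rad_in base.norm_inv_rad(1)[of 0 "proj_M z"] by (auto simp: radius_def)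
  have p: "continuous_on D (\<lambda>z. peak (base.inv_rad 0 (proj_M z)))"
    by (rule continuous_on_compose2[OF continuous_on_peak x]) (use xm r in fastforce)
  have "continuous_on D (\<lambda>z. fibre.inv_rad (base.inv_rad 0 (proj_M z)) (proj E z))"
    using D proj_in xm
    by (intro continuous_on_compose2[OF fibre.continuous_on_inv_rad,
            of D "\<lambda>z. (base.inv_rad 0 (proj_M z), proj E z)", simplified]
          continuous_intros x continuous_on_proj) (auto simp: radius_def)
  then show ?thesis unfolding chart_def D_def[symmetric] by (intro continuous_intros x p)
qed

text \<open>The clauses are imposed in stages, since each function is known to be continuous only
  where the earlier ones hold: \<open>W1\<close> is for \<open>peak\<close>, \<open>W2\<close> for
  the radial maps.\<close>

lemma nbhd_open: "open nbhd" and continuous_on_coord: "continuous_on nbhd coord"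
proof -
  define W1 where "W1 = {z. norm (proj_M z) < r / 2}"
  have W1: "open W1"
    using open_Collect_less_on[OF open_UNIV, of "\<lambda>z. norm (proj_M z)" "r / 2"]
    by (simp add: W1_def continuous_on_norm continuous_on_proj_M)
  have p1: "continuous_on W1 (\<lambda>z. peak (proj_M z))"
    by (rule continuous_on_compose2[OF continuous_on_peak continuous_on_proj_M])
       (use proj_M_in r in \<open>auto simp: W1_def\<close>)
  define W2 where "W2 = {z \<in> W1. norm (proj E z - peak (proj_M z)) < r / 2}"
  have W2: "open W2" unfolding W2_def
    by (intro open_Collect_less_on W1 continuous_intros continuous_on_proj p1)
  have p2: "continuous_on W2 (\<lambda>z. peak (proj_M z))"
    by (rule continuous_on_subset[OF p1]) (auto simp: W2_def)
  have inN: "proj E z - peak (proj_M z) \<in> N" if "z \<in> W2" for z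
    using that peak(1)[OF proj_M_in, of z] proj_in[of z] r subN by (auto simp: W2_def W1_def subspace_diff)
  have r1: "continuous_on W2 (\<lambda>z. base.rad 0 (proj_M z))"
    using proj_M_in
    by (intro continuous_on_compose2[OF base.continuous_on_rad, of W2 "\<lambda>z. (0, proj_M z)", simplified]
          continuous_intros continuous_on_proj_M) (auto simp: W2_def W1_def)
  have r2: "continuous_on W2 (\<lambda>z. fibre.rad (proj_M z) (proj E z - peak (proj_M z)))"
    using proj_M_in inN
    by (intro continuous_on_compose2[OF fibre.continuous_on_rad,
            of W2 "\<lambda>z. (proj_M z, proj E z - peak (proj_M z))", simplified]
          continuous_intros continuous_on_proj_M continuous_on_proj p2) (auto simp: W2_def W1_def)
  have "nbhd = {z \<in> W2. norm (base.rad 0 (proj_M z)) < radius} \<inter>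
      {z \<in> W2. norm (fibre.rad (proj_M z) (proj E z - peak (proj_M z))) < radius}"
    by (auto simp: nbhd_def W2_def W1_def)
  then show "open nbhd"
    using W2 r1 r2 by (auto intro!: open_Int open_Collect_less_on continuous_intros)
  show "continuous_on nbhd coord"
    unfolding coord_def
  proof (rule continuous_on_subset)
    show "continuous_on W2 (\<lambda>z. base.rad 0 (proj_M z) + fibre.rad (proj_M z) (proj E z - peak (proj_M z)))"
      by (intro continuous_intros r1 r2)
  qed (auto simp: nbhd_def W2_def W1_def)
qed

lemma radius_pos: "radius > 0"
  using b r by (simp add: radius_def)

lemma chart_0: "chart 0 = 0"
  using proj_M_unique[OF M0 N0] proj_add[OF M0 N0] by (simp add: chart_def)

lemma zero_in_nbhd: "0 \<in> nbhd"
  using chart_props(1)[OF M0 _ N0] radius_pos by (simp add: chart_0)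

lemma nbhd_subset: "nbhd \<subseteq> {x + y | x y. x \<in> M \<and> y \<in> N \<and> norm x < r \<and> norm y < r}"
proof
  fix z assume "z \<in> nbhd"
  from nbhdD[OF this] show "z \<in> {x + y | x y. x \<in> M \<and> y \<in> N \<and> norm x < r \<and> norm y < r}"
    using proj_M_in proj_in proj_M_proj[symmetric] by blast
qed

lemma homeomorphism_chart:
  "homeomorphism ((M \<inter> ball 0 radius) + (N \<inter> ball 0 radius)) nbhd chart coord"
proof
  have eq: "(M \<inter> ball 0 radius) + (N \<inter> ball 0 radius) =
      {u + v | u v. u \<in> M \<and> v \<in> N \<and> norm u < radius \<and> norm v < radius}"
    by (fastforce simp: set_plus_def)
  show "continuous_on ((M \<inter> ball 0 radius) + (N \<inter> ball 0 radius)) chart"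
    unfolding eq by (rule continuous_on_chart)
  show "continuous_on nbhd coord" by (rule continuous_on_coord)
  show "chart ` ((M \<inter> ball 0 radius) + (N \<inter> ball 0 radius)) \<subseteq> nbhd"
    using chart_props(1) by (auto simp: set_plus_def)
  show "coord ` nbhd \<subseteq> (M \<inter> ball 0 radius) + (N \<inter> ball 0 radius)"
    unfolding eq coord_def using nbhdD base.rad_in[OF proj_M_in] fibre.rad_in by blast
  show "\<And>z. z \<in> (M \<inter> ball 0 radius) + (N \<inter> ball 0 radius) \<Longrightarrow> coord (chart z) = z"
    using chart_props(2) by (auto simp: set_plus_def)
qed (rule chart_coord)

text \<open>Both \<open>chart\<close> and \<open>coord\<close> act on the \<open>M\<close>-component by rescaling, so they respect every
  subspace that contains \<open>N\<close>.\<close>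

lemma homeomorphism_chart_subspace:
  assumes K: "subspace K" "N \<subseteq> K"
  shows "homeomorphism ((K \<inter> M \<inter> ball 0 radius) + (N \<inter> ball 0 radius)) (nbhd \<inter> K) chart coord"
proof (rule homeomorphism_of_subsets[OF homeomorphism_chart, of _ nbhd])
  show "(K \<inter> M \<inter> ball 0 radius) + (N \<inter> ball 0 radius) \<subseteq> (M \<inter> ball 0 radius) + (N \<inter> ball 0 radius)"
    by (intro set_plus_mono2) auto
  show "chart ` ((K \<inter> M \<inter> ball 0 radius) + (N \<inter> ball 0 radius)) = nbhd \<inter> K"
  proof (intro equalityI subsetI)
    fix w assume "w \<in> chart ` ((K \<inter> M \<inter> ball 0 radius) + (N \<inter> ball 0 radius))"
    then obtain u v where uv: "u \<in> K" "u \<in> M" "norm u < radius" "v \<in> N" "norm v < radius"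
      "w = chart (u + v)" by (auto simp: set_plus_def)
    have w: "w \<in> nbhd" unfolding uv(6) using uv by (intro chart_props(1))
    define x where "x = base.inv_rad 0 u"
    have "x \<in> K"
      using K(1) uv(1) by (simp add: x_def base.inv_rad_def sgn_div_norm subspace_scale)
    moreover have "proj_M w = x"
    proof -
      have x: "x \<in> M" "norm x < r / 2"
        unfolding x_def using uv base.norm_inv_rad(1)[of 0 u] base.inv_rad_in[of u] by (auto simp: radius_def)
      have "peak x + fibre.inv_rad x v \<in> N"
        using peak(1)[OF x(1)] x r uv(4) fibre.inv_rad_in[of v x] subN by (simp add: subspace_add)
      then show ?thesis
        unfolding uv(6) chart_def using uv x by (simp add: proj_M_unique proj_add flip: x_def)
    qed
    ultimately show "w \<in> nbhd \<inter> K"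
      using w K proj_in[of w] proj_M_proj[of w] subspace_add[OF K(1), of "proj_M w" "proj E w"] by auto
  next
    fix w assume w: "w \<in> nbhd \<inter> K"
    then have n: "w \<in> nbhd" by simp
    \<comment> \<open>The N-component lies in \<open>K\<close> because \<open>K\<close> contains
      \<open>N\<close>, so \<open>K\<close> is closed under \<open>proj_M\<close> too.\<close>
    have "proj_M w \<in> K" using w K proj_in[of w] unfolding proj_M_def by (intro subspace_diff) auto
    then have "base.rad 0 (proj_M w) \<in> K"
      using K(1) by (simp add: base.rad_def sgn_div_norm subspace_scale)
    then have "coord w \<in> (K \<inter> M \<inter> ball 0 radius) + (N \<inter> ball 0 radius)"
      using nbhdD[OF n] base.rad_in[OF proj_M_in] fibre.rad_in unfolding coord_def
      by (intro set_plus_intro) auto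
    then show "w \<in> chart ` ((K \<inter> M \<inter> ball 0 radius) + (N \<inter> ball 0 radius))"
      using chart_coord[OF n] by (metis imageI)
  qed
qed simp

end

section \<open>Gradient estimates under Hypothesis (A)\<close>

text \<open>Riesz duality: evaluating the difference of two derivatives at the difference of the
  gradients bounds the latter.\<close>

lemma C1_gradient_continuous:
  assumes C1: "C1_on V L" and grad: "\<And>u. u \<in> V \<Longrightarrow> GDERIV L u :> g u"
  shows "continuous_on V g"
proof -
  obtain f' where f': "\<And>u. u \<in> V \<Longrightarrow> (L has_derivative blinfun_apply (f' u)) (at u)"
    and cont: "continuous_on V f'"
    using C1 by (auto simp: C1_on_def)
  have f'_eq: "f' u h = h \<bullet> g u" if "u \<in> V" for u h
    using has_derivative_unique[OF f'[OF that] grad[OF that, unfolded gderiv_def]] by metis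
  have le: "dist (g u) (g w) \<le> dist (f' u) (f' w)" if "u \<in> V" "w \<in> V" for u w
  proof -
    define d where "d = g u - g w"
    have "(norm d)\<^sup>2 = (f' u - f' w) d"
      by (simp add: f'_eq that blinfun.diff_left power2_norm_eq_inner) (simp add: d_def inner_diff_right)
    also have "\<dots> \<le> norm (f' u - f' w) * norm d" using norm_blinfun[of "f' u - f' w" d] by simp
    finally show ?thesis
      unfolding dist_norm d_def[symmetric] by (cases "d = 0") (auto simp: power2_eq_square)
  qed
  show ?thesis
    unfolding continuous_on_iff
  proof (intro ballI allI impI)
    fix u :: 'a and e :: real assume "u \<in> V" "e > 0"
    with cont obtain d where "d > 0" "\<And>w. w \<in> V \<Longrightarrow> dist w u < d \<Longrightarrow> dist (f' w) (f' u) < e"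
      unfolding continuous_on_iff by metis
    then show "\<exists>d>0. \<forall>w\<in>V. dist w u < d \<longrightarrow> dist (g w) (g u) < e"
      using le \<open>u \<in> V\<close> by (meson le_less_trans)
  qed
qed

text \<open>A vector-valued map has no mean value equality, but its pairing with a fixed
  \<open>w\<close> has one; the intermediate point depends on \<open>w\<close>.\<close>

lemma gateaux_mvt:
  fixes g :: "'a::real_normed_vector \<Rightarrow> 'b::real_inner"
  assumes "\<And>t. 0 \<le> t \<Longrightarrow> t \<le> 1 \<Longrightarrow> has_gateaux_derivative g (B (z + t *\<^sub>R (z' - z))) (z + t *\<^sub>R (z' - z))"
  obtains t where "0 < t" "t < 1" "(g z' - g z) \<bullet> w = B (z + t *\<^sub>R (z' - z)) (z' - z) \<bullet> w"
proof -
  define d where "d = z' - z"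
  have "((\<lambda>t. g (z + t *\<^sub>R d) \<bullet> w) has_real_derivative B (z + t *\<^sub>R d) d \<bullet> w) (at t)"
    if "0 \<le> t" "t \<le> 1" for t
  proof -
    have "((\<lambda>s. (g (z + t *\<^sub>R d + s *\<^sub>R d) - g (z + t *\<^sub>R d)) /\<^sub>R s) \<longlongrightarrow> B (z + t *\<^sub>R d) d) (at 0)"
      using assms[OF that] by (simp add: has_gateaux_derivative_def d_def)
    then have "((\<lambda>s. ((g (z + t *\<^sub>R d + s *\<^sub>R d) - g (z + t *\<^sub>R d)) /\<^sub>R s) \<bullet> w) \<longlongrightarrow> B (z + t *\<^sub>R d) d \<bullet> w) (at 0)"
      by (intro tendsto_intros)
    then show ?thesis
      by (simp add: DERIV_def inner_diff_left scaleR_add_left add.assoc divide_inverse mult.commute)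
  qed
  from MVT2[OF zero_less_one this]
  obtain t where "0 < t" "t < 1" "g (z + 1 *\<^sub>R d) \<bullet> w - g (z + 0 *\<^sub>R d) \<bullet> w = (1 - 0) * (B (z + t *\<^sub>R d) d \<bullet> w)"
    by blast
  then show ?thesis by (intro that[of t]) (auto simp: d_def inner_diff_left)
qed

locale nondegenerate_A =
  fixes V X :: "'a::{real_inner, complete_space} set" and g :: "'a \<Rightarrow> 'a"
    and B P Q :: "'a \<Rightarrow> 'a \<Rightarrow>\<^sub>L 'a"
  assumes X: "subspace X" and V: "0 \<in> V"
    and A: "hypothesis_A V X g B P Q"
    and ker: "\<And>u. B 0 u = 0 \<Longrightarrow> u = 0"
begin

section \<open>Hypothesis (A) turned into uniform bounds near the origin\<close>

lemma zero_VX: "0 \<in> V \<inter> X"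
  using V X by (simp add: subspace_0)

lemma
  shows sa: "x \<in> V \<inter> X \<Longrightarrow> self_adjoint (B x)"
    and gateaux: "x \<in> V \<inter> X \<Longrightarrow> has_gateaux_derivative g (B x) x"
    and decomposition: "x \<in> V \<inter> X \<Longrightarrow> B x = P x + Q x"
    and compact_Q: "x \<in> V \<inter> X \<Longrightarrow> compact_op (Q x)"
    and Q_cont: "continuous (at 0 within V \<inter> X) Q"
proof -
  note A' = A[unfolded hypothesis_A_def]
  note c1 = A'[THEN conjunct1] and c2 = A'[THEN conjunct2, THEN conjunct1]
  show "x \<in> V \<inter> X \<Longrightarrow> self_adjoint (B x)" "x \<in> V \<inter> X \<Longrightarrow> has_gateaux_derivative g (B x) x"
    using c1 by simp_all
  show "x \<in> V \<inter> X \<Longrightarrow> B x = P x + Q x" "x \<in> V \<inter> X \<Longrightarrow> compact_op (Q x)"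
    using c2 by simp_all
  show "continuous (at 0 within V \<inter> X) Q"
    by (rule A'[THEN conjunct2, THEN conjunct2, THEN conjunct2, THEN conjunct2, THEN conjunct1])
qed

lemma P_tendsto:
  assumes "\<And>k. x k \<in> V \<inter> X" "x \<longlonglongrightarrow> 0"
  shows "(\<lambda>k. P (x k) u) \<longlonglongrightarrow> P 0 u"
proof -
  have "(\<lambda>k. norm (P (x k) u - P 0 u)) \<longlonglongrightarrow> 0"
    using A[unfolded hypothesis_A_def, THEN conjunct2, THEN conjunct2, THEN conjunct2, THEN conjunct1]
      assms(1) tendsto_norm_zero[OF assms(2)] by blast
  then show ?thesis by (simp add: tendsto_norm_zero_iff LIM_zero_iff)
qed

lemma Q_tendsto:
  assumes "\<And>k. x k \<in> V \<inter> X" "x \<longlonglongrightarrow> 0"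
  shows "(\<lambda>k. Q (x k)) \<longlonglongrightarrow> Q 0"
  using continuous_within_tendsto_compose'[OF Q_cont assms] .

text \<open>(D4) gives a constant for each sequence. Uniformity follows by contradiction, with 1 /
  (k + 1) serving both as radius and as lower bound: a failure for every \<open>k\<close> yields a
  sequence to which (D4) applies.\<close>

lemma P_lower:
  obtains C0 d where "C0 > 0" "d > 0"
    "\<And>x u. x \<in> V \<inter> X \<Longrightarrow> norm x < d \<Longrightarrow> C0 * (norm u)\<^sup>2 \<le> P x u \<bullet> u"
proof -
  have "\<exists>k. \<forall>x\<in>V \<inter> X. norm x < inverse (real (Suc k)) \<longrightarrow>
      (\<forall>u. inverse (real (Suc k)) * (norm u)\<^sup>2 \<le> P x u \<bullet> u)"
  proof (rule ccontr)
    assume "\<not> ?thesis"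
    then obtain x u where xu: "\<And>k. x k \<in> V \<inter> X" "\<And>k. norm (x k) < inverse (real (Suc k))"
      "\<And>k. P (x k) (u k) \<bullet> u k < inverse (real (Suc k)) * (norm (u k))\<^sup>2"
      by (simp only: not_ex not_all Ball_def not_imp not_le) metis
    have le: "\<forall>k. norm (x k) \<le> inverse (real (Suc k))" using xu(2) less_imp_le by blast
    have "(\<lambda>k. norm (x k)) \<longlonglongrightarrow> 0"
      by (intro tendsto_norm_zero Lim_null_comparison[OF always_eventually[OF le] LIMSEQ_inverse_real_of_nat])
    then obtain C0 k0 where C0: "C0 > 0" "\<And>k u. k \<ge> k0 \<Longrightarrow> P (x k) u \<bullet> u \<ge> C0 * (norm u)\<^sup>2"
      using A[unfolded hypothesis_A_def, THEN conjunct2, THEN conjunct2, THEN conjunct2, THEN conjunct2,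
          THEN conjunct2, rule_format, of x] xu(1) by meson
    have "\<forall>\<^sub>F k in sequentially. inverse (real (Suc k)) < C0"
      by (rule order_tendstoD(2)[OF LIMSEQ_inverse_real_of_nat C0(1)])
    then have "\<forall>\<^sub>F k in sequentially. inverse (real (Suc k)) < C0 \<and> k \<ge> k0"
      using eventually_ge_at_top[of k0] by eventually_elim simp
    then obtain k where k: "inverse (real (Suc k)) < C0" "k \<ge> k0"
      using eventually_happens'[OF sequentially_bot] by blast
    have "inverse (real (Suc k)) * (norm (u k))\<^sup>2 \<le> C0 * (norm (u k))\<^sup>2"
      using k by (intro mult_right_mono) auto
    with C0(2)[OF k(2), of "u k"] xu(3)[of k] show False by linarith
  qed
  then obtain k where "\<forall>x\<in>V \<inter> X. norm x < inverse (real (Suc k)) \<longrightarrow>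
      (\<forall>u. inverse (real (Suc k)) * (norm u)\<^sup>2 \<le> P x u \<bullet> u)" ..
  then show ?thesis
    by (intro that[of "inverse (real (Suc k))" "inverse (real (Suc k))"]) auto
qed

lemma eigenbasis:
  obtains E where "orthonormal E" "finite E" "\<And>e. e \<in> E \<Longrightarrow> \<exists>l<0. B 0 e = l *\<^sub>R e"
    "\<And>u. u \<in> orthogonal_comp E \<Longrightarrow> u \<noteq> 0 \<Longrightarrow> B 0 u \<bullet> u > 0"
proof -
  obtain C0 d where C0: "C0 > 0" "d > 0"
    "\<And>x u. x \<in> V \<inter> X \<Longrightarrow> norm x < d \<Longrightarrow> C0 * (norm u)\<^sup>2 \<le> P x u \<bullet> u"
    using P_lower by blast
  have P0: "C0 * (norm u)\<^sup>2 \<le> P 0 u \<bullet> u" for u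
    using C0(3)[OF zero_VX] C0(2) by simp
  show ?thesis
    by (rule negative_eigenbasis[OF compact_Q[OF zero_VX] C0(1) P0, folded decomposition[OF zero_VX],
          OF sa[OF zero_VX] ker]) (assumption | rule that)+
qed

context
  fixes E :: "'a set"
  assumes E: "orthonormal E" "finite E" and ev: "\<And>e. e \<in> E \<Longrightarrow> \<exists>l<0. B 0 e = l *\<^sub>R e"
    and pos: "\<And>u. u \<in> orthogonal_comp E \<Longrightarrow> u \<noteq> 0 \<Longrightarrow> B 0 u \<bullet> u > 0"
begin

text \<open>Were there no uniform bound, approximate eigenvectors of \<open>B (x k)\<close> in the
  complement, with approximate eigenvalues at most \<open>r k\<close>, would produce an eigenvector
  of \<open>B 0\<close> there with eigenvalue at most 0. The same \<open>r k\<close> acts as radius,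
  bound and tolerance.\<close>

lemma B_pos:
  obtains a d where "a > 0" "d > 0"
    "\<And>x u. x \<in> V \<inter> X \<Longrightarrow> norm x < d \<Longrightarrow> u \<in> orthogonal_comp E \<Longrightarrow> a * (norm u)\<^sup>2 \<le> B x u \<bullet> u"
proof -
  obtain C0 d where C0: "C0 > 0" "d > 0"
    "\<And>x u. x \<in> V \<inter> X \<Longrightarrow> norm x < d \<Longrightarrow> C0 * (norm u)\<^sup>2 \<le> P x u \<bullet> u"
    using P_lower by blast
  define r where "r k = inverse (real (Suc k))" for k
  have r: "r \<longlonglongrightarrow> 0" "\<And>k. r k > 0" unfolding r_def by (rule LIMSEQ_inverse_real_of_nat) simp
  have "\<exists>k. \<forall>x\<in>V \<inter> X. norm x < min d (r k) \<longrightarrow>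
      (\<forall>u\<in>orthogonal_comp E. r k * (norm u)\<^sup>2 \<le> B x u \<bullet> u)"
  proof (rule ccontr)
    assume "\<not> ?thesis"
    then obtain x u where xu: "\<And>k. x k \<in> V \<inter> X" "\<And>k. norm (x k) < min d (r k)"
      "\<And>k. u k \<in> orthogonal_comp E" "\<And>k. B (x k) (u k) \<bullet> u k < r k * (norm (u k))\<^sup>2"
      by (simp only: not_ex not_all Ball_def not_imp not_le) metis
    have "\<exists>m w. m \<le> r k \<and> w \<in> orthogonal_comp E \<and> norm w = 1 \<and>
      (\<forall>v\<in>orthogonal_comp E. \<bar>(B (x k) w - m *\<^sub>R w) \<bullet> v\<bar> \<le> r k * norm v)" for k
    proof -
      have "u k \<noteq> 0" using xu(4)[of k] by auto
      from approx_eigenvector[OF sa[OF xu(1)] subspace_orthogonal_comp xu(3) this less_imp_le[OF xu(4)] r(2)[of k]]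
      show ?thesis by metis
    qed
    then obtain m w where mw: "\<And>k. m k \<le> r k" "\<And>k. w k \<in> orthogonal_comp E" "\<And>k. norm (w k) = 1"
      "\<And>k v. v \<in> orthogonal_comp E \<Longrightarrow> \<bar>(B (x k) (w k) - m k *\<^sub>R w k) \<bullet> v\<bar> \<le> r k * norm v"
      by metis
    have le: "\<forall>k. norm (x k) \<le> r k" using xu(2) by (auto intro: less_imp_le)
    have x0: "x \<longlonglongrightarrow> 0" by (rule Lim_null_comparison[OF always_eventually[OF le] r(1)])
    have P0: "C0 * (norm v)\<^sup>2 \<le> P (x k) v \<bullet> v" for k v
      using xu(2)[of k] by (intro C0 xu(1)) auto
    have ev': "\<exists>l. (P 0 + Q 0) e = l *\<^sub>R e" if "e \<in> E" for e
      using ev[OF that] unfolding decomposition[OF zero_VX] by blast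
    obtain h l where h: "l \<le> 0" "h \<in> orthogonal_comp E" "norm h = 1" "(P 0 + Q 0) h = l *\<^sub>R h"
      using limit_eigenvector[OF P_tendsto[OF xu(1) x0] Q_tendsto[OF xu(1) x0] compact_Q[OF zero_VX]
          C0(1) P0 sa[OF xu(1), unfolded decomposition[OF xu(1)]] E ev' mw(2,3,1) r(1)
          mw(4)[unfolded decomposition[OF xu(1)]]] by blast
    have "h \<noteq> 0" using h(3) by auto
    moreover have "B 0 h \<bullet> h = l"
      unfolding decomposition[OF zero_VX] h(4) using h(3) by (simp flip: power2_norm_eq_inner)
    ultimately show False using pos[OF h(2)] h(1) by simp
  qed
  then obtain k where "\<forall>x\<in>V \<inter> X. norm x < min d (r k) \<longrightarrow>
      (\<forall>u\<in>orthogonal_comp E. r k * (norm u)\<^sup>2 \<le> B x u \<bullet> u)" ..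
  then show ?thesis using r(2) C0(2) by (intro that[of "r k" "min d (r k)"]) auto
qed

text \<open>Strong convergence at the finitely many vectors of \<open>E\<close> controls the
  operators uniformly on their span.\<close>

lemma B_near:
  assumes "\<epsilon> > 0"
  obtains d where "d > 0"
    "\<And>x v. x \<in> V \<inter> X \<Longrightarrow> norm x < d \<Longrightarrow> v \<in> span E \<Longrightarrow> norm (B x v - B 0 v) \<le> \<epsilon> * norm v"
proof -
  define F where "F x = (\<Sum>e\<in>E. norm (B x e - B 0 e))" for x
  have "(\<lambda>k. F (x k)) \<longlonglongrightarrow> F 0" if x: "x \<longlonglongrightarrow> 0" "\<forall>k. x k \<in> V \<inter> X" for x
  proof -
    have xk: "x k \<in> V \<inter> X" for k using x(2) by blast
    have Be: "(\<lambda>k. B (x k) e) \<longlonglongrightarrow> B 0 e" for e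
      unfolding decomposition[OF xk] decomposition[OF zero_VX] blinfun.add_left
      by (intro tendsto_add P_tendsto xk x blinfun.tendsto[OF Q_tendsto tendsto_const])
    show ?thesis unfolding F_def
      by (intro tendsto_sum tendsto_norm tendsto_diff tendsto_const Be)
  qed
  then have "continuous (at 0 within V \<inter> X) F" by (rule continuous_within_sequentiallyI)
  then obtain d where d: "d > 0" "\<And>x. x \<in> V \<inter> X \<Longrightarrow> dist x 0 < d \<Longrightarrow> dist (F x) (F 0) < \<epsilon>"
    using assms unfolding continuous_within_eps_delta by metis
  have "norm (B x v - B 0 v) \<le> \<epsilon> * norm v" if x: "x \<in> V \<inter> X" "norm x < d" and v: "v \<in> span E" for x v
  proof -
    have v_eq: "v = (\<Sum>e\<in>E. (v \<bullet> e) *\<^sub>R e)" using proj_span[OF E v] by (simp add: proj_def)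
    have "B x v - B 0 v = (\<Sum>e\<in>E. (v \<bullet> e) *\<^sub>R (B x e - B 0 e))"
      by (subst (1 2) v_eq) (simp add: blinfun.sum_right blinfun.scaleR_right sum_subtractf scaleR_diff_right)
    also have "norm \<dots> \<le> (\<Sum>e\<in>E. norm v * norm (B x e - B 0 e))"
    proof (rule sum_norm_le)
      fix e assume "e \<in> E"
      then have "norm e = 1" using E(1) by (simp add: orthonormal_def norm_eq_sqrt_inner)
      then have "\<bar>v \<bullet> e\<bar> \<le> norm v" using Cauchy_Schwarz_ineq2[of v e] by simp
      then show "norm ((v \<bullet> e) *\<^sub>R (B x e - B 0 e)) \<le> norm v * norm (B x e - B 0 e)"
        by (simp add: mult_right_mono)
    qed
    also have "\<dots> = F x * norm v" by (simp add: F_def sum_distrib_left mult.commute)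
    also have "\<dots> \<le> \<epsilon> * norm v"
      using d(2)[OF x(1)] x(2) by (intro mult_right_mono) (auto simp: F_def dist_real_def)
    finally show ?thesis .
  qed
  with d(1) that show ?thesis by blast
qed

text \<open>\<open>B 0\<close> respects the splitting, so all coupling between the components comes
  from the deviation of \<open>B \<xi>\<close> from \<open>B 0\<close> on \<open>span E\<close>,
  which is small by \<open>B_near\<close>.\<close>

lemma gradient_estimates:
  assumes dense: "closure X = UNIV" and opV: "open V" and g_cont: "continuous_on V g"
  obtains b C d where "b > 0" "d > 0" "ball 0 d \<subseteq> V"
    "\<And>z z' p n. \<lbrakk>z \<in> ball 0 d; z' \<in> ball 0 d; n = proj E (z' - z); p = z' - z - n\<rbrakk> \<Longrightarrow>
      2 * b * (norm p)\<^sup>2 - b * norm p * norm n \<le> (g z' - g z) \<bullet> p \<and>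
      (g z' - g z) \<bullet> n \<le> - 2 * b * (norm n)\<^sup>2 + b * norm p * norm n \<and>
      (\<forall>v\<in>span E. (g z' - g z) \<bullet> v \<le> (b * norm p + C * norm n) * norm v)"
proof -
  obtain a d1 where a: "a > 0" "d1 > 0"
    "\<And>x u. x \<in> V \<inter> X \<Longrightarrow> norm x < d1 \<Longrightarrow> u \<in> orthogonal_comp E \<Longrightarrow> a * (norm u)\<^sup>2 \<le> B x u \<bullet> u"
    using B_pos by blast
  obtain c where c: "c > 0" "\<And>u. u \<in> span E \<Longrightarrow> B 0 u \<bullet> u \<le> - c * (norm u)\<^sup>2"
    using eigenbasis_negative[OF E ev] by blast
  \<comment> \<open>\<open>a / 2\<close> yields the diagonal constant \<open>2 * b\<close> on the
    complement; on the span a deviation of size \<open>b\<close> is lost, so \<open>c\<close> must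
    be at least \<open>3 * b\<close>.\<close>
  define b where "b = min (a / 2) (c / 3)"
  have b: "b > 0" "2 * b \<le> a" "3 * b \<le> c" using a c by (auto simp: b_def)
  obtain d2 where d2: "d2 > 0"
    "\<And>x v. x \<in> V \<inter> X \<Longrightarrow> norm x < d2 \<Longrightarrow> v \<in> span E \<Longrightarrow> norm (B x v - B 0 v) \<le> b * norm v"
    using B_near[OF b(1)] by blast
  obtain d3 where d3: "d3 > 0" "ball 0 d3 \<subseteq> V"
    using opV V open_contains_ball by blast
  define d where "d = min d1 (min d2 d3)"
  have d: "d > 0" "ball 0 d \<subseteq> V" using a d2 d3 by (auto simp: d_def)
  define C where "C = norm (B 0) + b"
  have orth: "B 0 n \<bullet> p = 0" if "n \<in> span E" "p \<in> orthogonal_comp E" for n p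
    using orthogonal_comp_span[OF that(2) eigenbasis_span_invariant[of E "B 0", OF _ that(1)]] ev
    by (subst inner_commute) blast
  have pN: "proj E w \<in> span E" and pM: "w - proj E w \<in> orthogonal_comp E" for w
    using proj_in_span diff_proj[OF E] by blast+
  let ?p = "\<lambda>z z'. z' - z - proj E (z' - z)" and ?n = "\<lambda>z z'. proj E (z' - z)"
  let ?G = "\<lambda>z z' v. 2 * b * (norm (?p z z'))\<^sup>2 - b * norm (?p z z') * norm (?n z z') \<le> (g z' - g z) \<bullet> ?p z z' \<and>
      (g z' - g z) \<bullet> ?n z z' \<le> - 2 * b * (norm (?n z z'))\<^sup>2 + b * norm (?p z z') * norm (?n z z') \<and>
      (g z' - g z) \<bullet> v \<le> (b * norm (?p z z') + C * norm (?n z z')) * norm v"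
  have on_X: "?G z z' v" if z: "z \<in> ball 0 d \<inter> X" "z' \<in> ball 0 d \<inter> X" and v: "v \<in> span E" for z z' v
  proof -
    define n p where "n = ?n z z'" and "p = ?p z z'"
    have n: "n \<in> span E" and p: "p \<in> orthogonal_comp E" using pN pM by (auto simp: n_def p_def)
    have pn: "z' - z = p + n" by (simp add: p_def n_def)
    have seg: "z + t *\<^sub>R (z' - z) \<in> ball 0 d \<inter> X" if "0 \<le> t" "t \<le> 1" for t
    proof
      have "(1 - t) *\<^sub>R z + t *\<^sub>R z' \<in> ball 0 d"
        using z that by (intro convexD[OF convex_ball]) auto
      then show "z + t *\<^sub>R (z' - z) \<in> ball 0 d" by (simp add: algebra_simps)
      show "z + t *\<^sub>R (z' - z) \<in> X"
        using z X by (intro subspace_add subspace_scale subspace_diff) auto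
    qed
    \<comment> \<open>The point \<xi> varies with \<open>w\<close>, so each of the three estimates
      takes its own.\<close>
    have mv: "\<exists>\<xi>. \<xi> \<in> V \<inter> X \<and> norm \<xi> < d \<and> (g z' - g z) \<bullet> w = B \<xi> p \<bullet> w + B \<xi> n \<bullet> w" for w
    proof -
      obtain t where t: "0 < t" "t < 1" "(g z' - g z) \<bullet> w = B (z + t *\<^sub>R (z' - z)) (z' - z) \<bullet> w"
        by (rule gateaux_mvt[of g B z z' w]) (use gateaux seg d in blast)+
      moreover have "z + t *\<^sub>R (z' - z) \<in> ball 0 d \<inter> X" using seg t by simp
      ultimately show ?thesis
        using d by (intro exI[of _ "z + t *\<^sub>R (z' - z)"]) (auto simp: pn blinfun.add_right inner_add_left)
    qed
    have near: "\<bar>(B \<xi> v - B 0 v) \<bullet> w\<bar> \<le> b * norm v * norm w"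
      if "\<xi> \<in> V \<inter> X" "norm \<xi> < d" "v \<in> span E" for \<xi> v w
    proof -
      have "norm (B \<xi> v - B 0 v) \<le> b * norm v" using d2(2) that by (simp add: d_def)
      then show ?thesis
        using Cauchy_Schwarz_ineq2[of "B \<xi> v - B 0 v" w] mult_right_mono[of _ _ "norm w"]
        by (meson norm_ge_zero order_trans)
    qed
    \<comment> \<open>Nearness to \<open>B 0\<close> is known only on \<open>span E\<close>;
      symmetry moves the operator onto the factor that lies there.\<close>
    have sym: "B \<xi> p \<bullet> w = B \<xi> w \<bullet> p" if "\<xi> \<in> V \<inter> X" for \<xi> w p
      using sa[OF that] by (simp add: self_adjoint_def inner_commute)
    have G1: "2 * b * (norm p)\<^sup>2 - b * norm p * norm n \<le> (g z' - g z) \<bullet> p"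
    proof -
      obtain \<xi> where xi: "\<xi> \<in> V \<inter> X" "norm \<xi> < d" "(g z' - g z) \<bullet> p = B \<xi> p \<bullet> p + B \<xi> n \<bullet> p"
        using mv by blast
      have "2 * b * (norm p)\<^sup>2 \<le> a * (norm p)\<^sup>2" using b by (intro mult_right_mono) auto
      also have "\<dots> \<le> B \<xi> p \<bullet> p" using a(3)[OF xi(1) _ p] xi(2) by (simp add: d_def)
      finally show ?thesis
        using xi(3) near[OF xi(1,2) n, of p] orth[OF n p] by (simp add: inner_diff_left mult_ac)
    qed
    have G2: "(g z' - g z) \<bullet> n \<le> - 2 * b * (norm n)\<^sup>2 + b * norm p * norm n"
    proof -
      obtain \<xi> where xi: "\<xi> \<in> V \<inter> X" "norm \<xi> < d" "(g z' - g z) \<bullet> n = B \<xi> p \<bullet> n + B \<xi> n \<bullet> n"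
        using mv by blast
      have "B \<xi> p \<bullet> n \<le> b * norm p * norm n"
        using near[OF xi(1,2) n, of p] orth[OF n p] sym[OF xi(1), of p n]
        by (simp add: inner_diff_left mult_ac)
      moreover have "B \<xi> n \<bullet> n \<le> - c * (norm n)\<^sup>2 + b * (norm n)\<^sup>2"
        using near[OF xi(1,2) n, of n] c(2)[OF n] by (simp add: inner_diff_left power2_eq_square mult_ac)
      moreover have "3 * b * (norm n)\<^sup>2 \<le> c * (norm n)\<^sup>2" using b by (intro mult_right_mono) auto
      ultimately show ?thesis using xi(3) by simp
    qed
    have G3: "(g z' - g z) \<bullet> v \<le> (b * norm p + C * norm n) * norm v"
    proof -
      obtain \<xi> where xi: "\<xi> \<in> V \<inter> X" "norm \<xi> < d" "(g z' - g z) \<bullet> v = B \<xi> p \<bullet> v + B \<xi> n \<bullet> v"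
        using mv by blast
      have 1: "B \<xi> p \<bullet> v \<le> b * norm p * norm v"
        using near[OF xi(1,2) v, of p] orth[OF v p] sym[OF xi(1), of p v]
        by (simp add: inner_diff_left mult_ac)
      have "B \<xi> n \<bullet> v = (B \<xi> v - B 0 v) \<bullet> n + B 0 v \<bullet> n"
        using sym[OF xi(1), of n v] by (simp add: inner_diff_left)
      moreover have "(B \<xi> v - B 0 v) \<bullet> n \<le> b * norm v * norm n"
        using near[OF xi(1,2) v, of n] by simp
      moreover have "B 0 v \<bullet> n \<le> norm (B 0) * norm v * norm n"
        using norm_cauchy_schwarz[of "B 0 v" n] mult_right_mono[OF norm_blinfun[of "B 0" v] norm_ge_zero[of n]]
        by linarith
      ultimately have "B \<xi> n \<bullet> v \<le> C * norm n * norm v" by (simp add: C_def algebra_simps)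
      with 1 xi(3) show ?thesis by (simp add: algebra_simps)
    qed
    show ?thesis using G1 G2 G3 by (simp add: n_def p_def)
  qed
  \<comment> \<open>The inequalities are not strict, so they pass from the dense set
    \<open>X\<close> to the ball by continuity of \<open>g\<close>.\<close>
  have on_ball: "?G z z' v" if z: "z \<in> ball 0 d" "z' \<in> ball 0 d" and v: "v \<in> span E" for z z' v
  proof -
    have "ball 0 d \<subseteq> closure (ball 0 d \<inter> X)"
      using open_Int_closure_subset[OF open_ball, of 0 d X] dense by simp
    then have "\<exists>s. (\<forall>k. s k \<in> ball 0 d \<inter> X) \<and> s \<longlonglongrightarrow> w" if "w \<in> ball 0 d" for w
      using that closure_sequential[of w "ball 0 d \<inter> X"] by blast
    then obtain s s' where s: "\<And>k. s k \<in> ball 0 d \<inter> X" "s \<longlonglongrightarrow> z"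
      and s': "\<And>k. s' k \<in> ball 0 d \<inter> X" "s' \<longlonglongrightarrow> z'"
      using z by metis
    have gs: "(\<lambda>k. g (s k)) \<longlonglongrightarrow> g z" "(\<lambda>k. g (s' k)) \<longlonglongrightarrow> g z'"
      using s(1) s'(1) z d(2)
      by (intro continuous_on_tendsto_compose[OF g_cont] s(2) s'(2) always_eventually; blast)+
    have pr: "(\<lambda>k. proj E (s' k - s k)) \<longlonglongrightarrow> proj E (z' - z)"
      by (intro bounded_linear.tendsto[OF bounded_linear_proj] tendsto_intros s s')
    note lim = tendsto_intros gs pr s(2) s'(2)
    show ?thesis
    proof (intro conjI)
      show "2 * b * (norm (?p z z'))\<^sup>2 - b * norm (?p z z') * norm (?n z z') \<le> (g z' - g z) \<bullet> ?p z z'"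
        by (rule LIMSEQ_le[where X="\<lambda>k. 2 * b * (norm (?p (s k) (s' k)))\<^sup>2 - b * norm (?p (s k) (s' k)) * norm (?n (s k) (s' k))"
              and Y="\<lambda>k. (g (s' k) - g (s k)) \<bullet> ?p (s k) (s' k)"])
           (intro lim | use on_X[OF s(1) s'(1) v] in blast)+
      show "(g z' - g z) \<bullet> ?n z z' \<le> - 2 * b * (norm (?n z z'))\<^sup>2 + b * norm (?p z z') * norm (?n z z')"
        by (rule LIMSEQ_le[where X="\<lambda>k. (g (s' k) - g (s k)) \<bullet> ?n (s k) (s' k)"
              and Y="\<lambda>k. - 2 * b * (norm (?n (s k) (s' k)))\<^sup>2 + b * norm (?p (s k) (s' k)) * norm (?n (s k) (s' k))"])
           (intro lim | use on_X[OF s(1) s'(1) v] in blast)+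
      show "(g z' - g z) \<bullet> v \<le> (b * norm (?p z z') + C * norm (?n z z')) * norm v"
        by (rule LIMSEQ_le[where X="\<lambda>k. (g (s' k) - g (s k)) \<bullet> v"
              and Y="\<lambda>k. (b * norm (?p (s k) (s' k)) + C * norm (?n (s k) (s' k))) * norm v"])
           (intro lim | use on_X[OF s(1) s'(1) v] in blast)+
    qed
  qed
  show ?thesis
  proof (rule that[OF b(1) d])
    fix z z' p n assume "z \<in> ball 0 d" "z' \<in> ball 0 d" and n: "n = proj E (z' - z)" "p = z' - z - n"
    then have G: "?G z z' v" if "v \<in> span E" for v using on_ball[OF _ _ that] by blast
    show "2 * b * (norm p)\<^sup>2 - b * norm p * norm n \<le> (g z' - g z) \<bullet> p \<and>
      (g z' - g z) \<bullet> n \<le> - 2 * b * (norm n)\<^sup>2 + b * norm p * norm n \<and>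
      (\<forall>v\<in>span E. (g z' - g z) \<bullet> v \<le> (b * norm p + C * norm n) * norm v)"
      unfolding n(2) unfolding n(1) using G G[OF span_zero] by blast
  qed
qed

end

end

theorem theorem2p1:
  fixes X V :: "'a::{real_inner, complete_space} set"
    and L :: "'a \<Rightarrow> real"
    and gradL :: "'a \<Rightarrow> 'a"
    and B P Q :: "'a \<Rightarrow> 'a \<Rightarrow>\<^sub>L 'a"
    and Hp H0 Hm :: "'a set"
  assumes X: "subspace X" "closure X = UNIV"
    and V: "open V" "0 \<in> V"
    and C1: "C1_on V L"
    and grad: "\<forall>u\<in>V. GDERIV L u :> gradL u"
    and crit: "(L has_derivative (\<lambda>h. 0)) (at 0)"
    and A: "hypothesis_A V X gradL B P Q"
    and split: "Hp = pos_space (B 0)" "H0 = null_space (B 0)" "Hm = neg_space (B 0)"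
    and nondegenerate: "H0 = {0}"
  shows "0 isolated_in critical_points V L \<and>
    (\<exists>\<epsilon>>0. \<exists>W \<phi> \<psi>.
       open W \<and> 0 \<in> W \<and> W \<subseteq> V \<and>
       homeomorphism ((Hp \<inter> ball 0 \<epsilon>) + (Hm \<inter> ball 0 \<epsilon>)) W \<phi> \<psi> \<and> \<phi> 0 = 0 \<and>
       (\<forall>u \<in> Hp \<inter> ball 0 \<epsilon>. \<forall>v \<in> Hm \<inter> ball 0 \<epsilon>.
          L (\<phi> (u + v)) = (norm u)\<^sup>2 - (norm v)\<^sup>2 + L 0) \<and>
       (\<forall>K. subspace K \<and> closed K \<and> Hm \<subseteq> K \<longrightarrow>
          K \<inter> Hp = K \<inter> orthogonal_comp Hm \<and>
          homeomorphism ((K \<inter> Hp \<inter> ball 0 \<epsilon>) + (Hm \<inter> ball 0 \<epsilon>)) (W \<inter> K) \<phi> \<psi> \<and>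
          (\<forall>u \<in> K \<inter> Hp \<inter> ball 0 \<epsilon>. \<forall>v \<in> Hm \<inter> ball 0 \<epsilon>.
             L (\<phi> (u + v)) = (norm u)\<^sup>2 - (norm v)\<^sup>2 + L 0)))"
proof -
  let ?B = "B 0"
  have grad': "\<And>u. u \<in> V \<Longrightarrow> GDERIV L u :> gradL u" using grad by blast
  have ker: "?B u = 0 \<Longrightarrow> u = 0" for u
    using nondegenerate split(2) by (auto simp: null_space_def)
  interpret hyp: nondegenerate_A V X gradL B P Q
    using X V A ker by unfold_locales
  obtain E where E: "orthonormal E" "finite E" and ev: "\<And>e. e \<in> E \<Longrightarrow> \<exists>l<0. ?B e = l *\<^sub>R e"
    and pos: "\<And>u. u \<in> orthogonal_comp E \<Longrightarrow> u \<noteq> 0 \<Longrightarrow> ?B u \<bullet> u > 0"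
    using hyp.eigenbasis by blast
  have Hm: "Hm = span E"
    using neg_space_eq[OF E hyp.sa[OF hyp.zero_VX] ev pos] split(3) by simp
  have Hp: "Hp = orthogonal_comp E"
    using pos_space_eq[OF hyp.sa[OF hyp.zero_VX] ev pos] split(1) by simp
  \<comment> \<open>This identifies \<open>K \<inter> Hp\<close> with the orthogonal complement of
    \<open>Hm\<close> in \<open>K\<close>.\<close>
  have comp_Hm: "orthogonal_comp Hm = Hp"
    unfolding Hm Hp
  proof (intro equalityI subsetI)
    fix x assume "x \<in> orthogonal_comp (span E)"
    then show "x \<in> orthogonal_comp E" by (simp add: orthogonal_comp_iff span_base)
  next
    fix x assume "x \<in> orthogonal_comp E"
    then show "x \<in> orthogonal_comp (span E)"
      using orthogonal_comp_span unfolding orthogonal_comp_iff[of _ "span E"] by blast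
  qed
  obtain b C d where b: "b > 0" and d: "d > 0" "ball 0 d \<subseteq> V"
    and est: "\<And>z z' p n. \<lbrakk>z \<in> ball 0 d; z' \<in> ball 0 d; n = proj E (z' - z); p = z' - z - n\<rbrakk> \<Longrightarrow>
      2 * b * (norm p)\<^sup>2 - b * norm p * norm n \<le> (gradL z' - gradL z) \<bullet> p \<and>
      (gradL z' - gradL z) \<bullet> n \<le> - 2 * b * (norm n)\<^sup>2 + b * norm p * norm n \<and>
      (\<forall>v\<in>span E. (gradL z' - gradL z) \<bullet> v \<le> (b * norm p + C * norm n) * norm v)"
    by (rule hyp.gradient_estimates[OF E ev pos X(2) V(1) C1_gradient_continuous[OF C1 grad']]) (assumption | rule that)+
  have grad_0: "gradL z = 0" if "z \<in> V" "(L has_derivative (\<lambda>h. 0)) (at z)" for z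
  proof -
    have "(\<lambda>h. h \<bullet> gradL z) = (\<lambda>h. 0)"
      using has_derivative_unique[OF grad'[OF that(1), unfolded gderiv_def] that(2)] .
    then have "gradL z \<bullet> gradL z = 0" by metis
    then show ?thesis by simp
  qed
  \<comment> \<open>The box has half the radius of the ball, so that sums of its components stay in
    the ball.\<close>
  have in_ball: "x + y \<in> ball 0 d" if "norm x < d / 2" "norm y < d / 2" for x y :: 'a
    using norm_triangle_ineq[of x y] that by simp
  have box: "2 * b * (norm (x' - x))\<^sup>2 - b * norm (x' - x) * norm (y' - y)
          \<le> (gradL (x' + y') - gradL (x + y)) \<bullet> (x' - x) \<and>
      (gradL (x' + y') - gradL (x + y)) \<bullet> (y' - y)
          \<le> - 2 * b * (norm (y' - y))\<^sup>2 + b * norm (x' - x) * norm (y' - y) \<and>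
      (\<forall>v\<in>span E. (gradL (x' + y') - gradL (x + y)) \<bullet> v
          \<le> (b * norm (x' - x) + C * norm (y' - y)) * norm v)"
    if "x \<in> orthogonal_comp E" "x' \<in> orthogonal_comp E" "y \<in> span E" "y' \<in> span E"
      "norm x < d / 2" "norm x' < d / 2" "norm y < d / 2" "norm y' < d / 2" for x x' y y'
  proof (rule est)
    show "x + y \<in> ball 0 d" "x' + y' \<in> ball 0 d" using that in_ball by blast+
    have "proj E ((x' - x) + (y' - y)) = y' - y"
      using that by (intro proj_unique E subspace_diff subspace_orthogonal_comp span_diff)
    then show "y' - y = proj E (x' + y' - (x + y))" by (simp add: algebra_simps)
  qed (simp add: algebra_simps)
  interpret saddle E L gradL b C "d / 2" "orthogonal_comp E" "span E"
  proof unfold_locales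
    show "gradL 0 = 0" using grad_0[OF V(2) crit] .
    fix x y :: 'a assume "norm x < d / 2" "norm y < d / 2"
    then show "GDERIV L (x + y) :> gradL (x + y)" using grad' d(2) in_ball by blast
  qed (use E b d box in auto)
  have iso: "0 isolated_in critical_points V L"
    unfolding isolated_in_def
  proof (intro conjI exI[of _ "ball 0 (d / 2)"])
    show "0 \<in> critical_points V L" using V crit by (simp add: critical_points_def)
    have "z = 0" if z: "z \<in> critical_points V L" "norm z < d / 2" for z
    proof -
      \<comment> \<open>Both projections are norm-decreasing, so the ball of radius
        \<open>d / 2\<close> lies in the box.\<close>
      have "norm (proj E z) < d / 2" "norm (proj_M z) < d / 2"
        using norm_proj_le[OF E, of z] norm_diff_proj_le[OF E, of z] z(2) by (auto simp: proj_M_def)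
      moreover have "gradL (proj_M z + proj E z) = 0"
        using grad_0 z(1) by (simp add: proj_M_proj critical_points_def)
      ultimately have "proj_M z + proj E z = 0"
        using proj_M_in proj_in by (intro critical_point_0)
      then show ?thesis by (simp add: proj_M_proj)
    qed
    then show "ball 0 (d / 2) \<inter> critical_points V L = {0}"
      using d \<open>0 \<in> critical_points V L\<close> by auto
  qed simp
  have sub_V: "nbhd \<subseteq> V"
    using nbhd_subset in_ball d(2) by blast
  have K_part: "homeomorphism ((K \<inter> Hp \<inter> ball 0 radius) + (Hm \<inter> ball 0 radius)) (nbhd \<inter> K) chart coord"
    if "subspace K" "Hm \<subseteq> K" for K
    using homeomorphism_chart_subspace[of K] that unfolding Hp Hm by simp
  have normal_form: "L (chart (u + v)) = (norm u)\<^sup>2 - (norm v)\<^sup>2 + L 0"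
    if "u \<in> Hp \<inter> ball 0 radius" "v \<in> Hm \<inter> ball 0 radius" for u v
    using that chart_props(3) unfolding Hp Hm by simp
  have homeo: "homeomorphism ((Hp \<inter> ball 0 radius) + (Hm \<inter> ball 0 radius)) nbhd chart coord"
    using homeomorphism_chart unfolding Hp Hm .
  show ?thesis
    by (rule conjI[OF iso], rule exI[of _ radius], rule conjI[OF radius_pos],
        rule exI[of _ nbhd], rule exI[of _ chart], rule exI[of _ coord])
       (simp add: nbhd_open zero_in_nbhd sub_V homeo chart_0 normal_form K_part comp_Hm)
qed

end
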